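(* Let $\alpha>0$ and let $\boldsymbol L=(L_1,\ldots,L_d):\mathcal T=\mathbb R^p\to[0,\infty)^d$ be a deterministic function with continuous components such that, for some norm $\|\cdot\|_*$ on $\mathbb R^d$ and any (nonempty) compact set $K\subset\mathbb R^p$, $$0<\int_{\mathcal T}\|\boldsymbol L(t)\|_*^\alpha\,\lambda(dt)\le\int_{\mathcal T}\sup_{s\in K}\|\boldsymbol L(t-s)\|_*^\alpha\,\lambda(dt)<\infty .$$ Let $W$ be a $\mathcal T$-valued random variable with positive density $p(t)>0$, $t\in\mathcal T$, and let $\boldsymbol X$ be the max-stable (Smith) process with index $\alpha$ and spectral process $$\boldsymbol Z(t)=(1/p(W))^{1/\alpha}\boldsymbol L(t-W),\qquad t\in\mathcal T .$$ (a) For any $h\in\mathcal T$ and any norm $\|\cdot\|$ on $\mathbb R^d$, the tilted process $\boldsymbol\Theta^{[h]}$ calculated with respect to this norm satisfies, in law, $$\boldsymbol\Theta^{[h]}(t)=\boldsymbol L(t-h+S)/\|\boldsymbol L(S)\|=B^h\boldsymbol\Theta^{[0]}(t),\qquad t\in\mathcal T,$$ where $S$ is a $\mathcal T$-valued random variable with density $\|\boldsymbol L(t)\|^\alpha/c$, $t\in\mathcal T$, and $c=\int_{\mathcal T}\|\boldsymbol L(t)\|^\alpha\lambda(dt)$. (b) For any $h\in\mathcal T$ and any positive integer $k\le d$ such that $c_k:=\int_{\mathcal T}L_k^\alpha(t)\,\lambda(dt)>0$, in law, $$\boldsymbol\Theta^{[h,k]}(t)=\boldsymbol L(t-h+S_k)/L_k(S_k),\qquad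 t\in\mathcal T,$$ where $S_k$ is a $\mathcal T$-valued random variable with density $L_k^\alpha(t)/c_k$, $t\in\mathcal T$. (c) If further $c_k\in(0,\infty)$ for all $k\le d$, and $c_\infty=\int_{\mathcal T}\|\boldsymbol L(t)\|_\infty^\alpha\,\lambda(dt)$, then for any $t_i\in\mathcal T$, $\boldsymbol x_i\in(0,\infty)^d$, $1\le i\le n$, $$-\ln\mathbb P\{\boldsymbol X(t_i)\le\boldsymbol x_i,\,1\le i\le n\}=c_\infty\sum_{1\le l\le n}\mathbb E\left\{\frac{\|\boldsymbol L(S)/\boldsymbol x_l\|_\infty^\alpha}{\|\boldsymbol L(S)\|_\infty^\alpha}\;\mathbb I\Bigl(\operatorname{infargmax}_{1\le j\le n}\|\boldsymbol L(t_j-t_l+S)/\boldsymbol x_j\|_\infty=l\Bigr)\right\}$$ $$=\sum_{(k,l)\in J}\frac{c_k}{x_{kl}^\alpha}\;\mathbb P\left\{\operatorname{infargmax}_{(i,j)\in J}\frac{L_i(t_j-t_l+S_k)}{x_{ij}\,L_k(S_k)}=(k,l)\right\},$$ where $J=\{(i,j):1\le i\le d,\ 1\le j\le n\}$ and in the first expression $S$ has density $\|\boldsymbol L(t)\|_\infty^\alpha/c_\infty$, $t\in\mathcal T$.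
   Context: Here $d,p,n$ are positive integers, $\mathcal T=\mathbb R^p$, $\lambda$ is Lebesgue measure on $\mathcal T$, $\|\boldsymbol x\|_\infty=\max_{1\le i\le d}|x_i|$, $\mathbb I$ is the indicator function, and $B^hf(t)=f(t-h)$. Write $\boldsymbol x_j=(x_{1j},\ldots,x_{dj})$, so $x_{ij}$ is the $i$th component of $\boldsymbol x_j$; inequalities and quotients of vectors are componentwise. $C$ is the space of continuous functions $f:\mathcal T\to[0,\infty)^d$ with the $\sigma$-field $\mathcal C$ generated by the projections $f\mapsto f(t)$. A process $\boldsymbol Z=(Z_1,\ldots,Z_d)$ with paths in $C$ is a spectral process of the max-stable process $\boldsymbol X$ with index $\alpha$ if $\boldsymbol X$ has the same law as $\max_{i\ge1}\Gamma_i^{-1/\alpha}\boldsymbol Z^{(i)}(t)$, $t\in\mathcal T$ (componentwise maximum), where $\Gamma_i=\sum_{k=1}^iE_k$ with $E_k$ independent unit exponential random variables, independent of the independent copies $\boldsymbol Z^{(i)}$, $i\ge1$, of $\boldsymbol Z$. Tilted processes: $\boldsymbol\Theta^{[h]}$ (with respect to a norm $\|\cdot\|$) and $\boldsymbol\Theta^{[h,k]}$ are the processes with laws $$\mathbb P\{\boldsymbol\Theta^{[h]}\in A\}=\frac{\mathbb E\{\|\boldsymbol Z(h)\|^\alpha\,\mathbb I(\boldsymbol Z/\|\boldsymbol Z(h)\|\in A)\}}{\mathbb E\{\|\boldsymbol Z(h)\|^\alpha\}},\qquad \mathbb P\{\boldsymbol\Theta^{[h,k]}\in A\}=\frac{\mathbb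 E\{Z_k^\alpha(h)\,\mathbb I(\boldsymbol Z/Z_k(h)\in A)\}}{\mathbb E\{Z_k^\alpha(h)\}},\quad A\in\mathcal C$$ (the latter when $\mathbb E\{Z_k^\alpha(h)\}>0$), with the integrands taken as $0$ when $\|\boldsymbol Z(h)\|=0$, respectively $Z_k(h)=0$. $\operatorname{infargmax}$ denotes the smallest index at which the maximum is attained, where indices in $\{1,\ldots,n\}$ are ordered naturally and indices in $J\subset\mathbb Z^2$ lexicographically. *)

theory Defs
  imports "HOL-Probability.Probability"
begin

text \<open>The index set \<open>{1, ..., d}\<close> is a type \<open>'d\<close> of sort \<open>{finite, linorder}\<close>, so that \<open>\<real>\<^sup>d\<close> is
  \<open>real ^ 'd\<close> and the components carry an order; \<open>\<T> = \<real>\<^sup>p\<close> is \<open>real ^ 'p\<close>. The maximum norm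
  is \<^const>\<open>infnorm\<close>.\<close>

definition is_norm :: "('v::real_vector \<Rightarrow> real) \<Rightarrow> bool" where
  "is_norm N \<longleftrightarrow> (\<forall>x. 0 \<le> N x) \<and> (\<forall>x. N x = 0 \<longleftrightarrow> x = 0) \<and>
     (\<forall>a x. N (a *\<^sub>R x) = \<bar>a\<bar> * N x) \<and> (\<forall>x y. N (x + y) \<le> N x + N y)"

definition vdiv :: "real ^ 'd \<Rightarrow> real ^ 'd \<Rightarrow> real ^ 'd" where
  "vdiv x y = (\<chi> i. x $ i / y $ i)"

definition cpaths :: "(real ^ 'p \<Rightarrow> real ^ 'd) set" where
  "cpaths = {f. continuous_on UNIV f \<and> (\<forall>t i. 0 \<le> f t $ i)}"

definition path_space :: "(real ^ 'p \<Rightarrow> real ^ 'd) measure" where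
  "path_space = sigma cpaths {{f \<in> cpaths. f t \<in> B} | t B. B \<in> sets borel}"

definition backshift :: "real ^ 'p \<Rightarrow> (real ^ 'p \<Rightarrow> real ^ 'd) \<Rightarrow> real ^ 'p \<Rightarrow> real ^ 'd" where
  "backshift h f = (\<lambda>t. f (t - h))"

text \<open>The law of the tilted process: \<open>\<Theta>\<close>[h] is the case where \<open>g\<close> is a norm, and \<open>\<Theta>\<close>[h,k] the case
  where \<open>g\<close> is the \<open>k\<close>-th coordinate. Since \<open>0 powr \<alpha> = 0\<close>, the integrand vanishes where
  \<open>g (Z \<omega> h) = 0\<close>.\<close>

definition tilted_law ::
  "real \<Rightarrow> (real ^ 'd \<Rightarrow> real) \<Rightarrow> 'm measure \<Rightarrow> ('m \<Rightarrow> real ^ 'p \<Rightarrow> real ^ 'd) \<Rightarrow> real ^ 'p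
    \<Rightarrow> (real ^ 'p \<Rightarrow> real ^ 'd) measure" where
  "tilted_law \<alpha> g M Z h =
     measure_of (space path_space) (sets path_space)
       (\<lambda>A. (\<integral>\<^sup>+\<omega>. ennreal (g (Z \<omega> h) powr \<alpha>) * indicator A (\<lambda>t. Z \<omega> t /\<^sub>R g (Z \<omega> h)) \<partial>M)
            / (\<integral>\<^sup>+\<omega>. ennreal (g (Z \<omega> h) powr \<alpha>) \<partial>M))"

text \<open>\<open>Z\<close> is a spectral process of \<open>X\<close> with index \<open>\<alpha>\<close>. The sequences are indexed from 0, so
  \<open>\<Gamma>\<close> with index \<open>i\<close> is \<open>\<Sum>k\<le>i. E k \<omega>\<close>. The supremum of the series is taken in \<^typ>\<open>ennreal\<close> because
  it may be infinite on a null set; the two laws are compared on the product sigma-field over all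
  times and components. Independence of the two sequences is stated for the sigma-fields they
  generate, because \<open>indep_var\<close> requires both variables to have the same type. The type argument is
  the sample space carrying the series.\<close>

definition spectral_process ::
  "'r itself \<Rightarrow> real \<Rightarrow> 'm measure \<Rightarrow> ('m \<Rightarrow> real ^ 'p \<Rightarrow> real ^ 'd)
    \<Rightarrow> 'x measure \<Rightarrow> ('x \<Rightarrow> real ^ 'p \<Rightarrow> real ^ 'd) \<Rightarrow> bool" where
  "spectral_process (_ :: 'r itself) \<alpha> M Z P X \<longleftrightarrow>
     prob_space M \<and> Z \<in> measurable M path_space \<and>
     prob_space P \<and> (\<forall>t. (\<lambda>\<omega>. X \<omega> t) \<in> borel_measurable P) \<and>
     (\<forall>\<omega> \<in> space P. \<forall>t i. 0 \<le> X \<omega> t $ i) \<and>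
     (\<exists>(R :: 'r measure) (E :: nat \<Rightarrow> 'r \<Rightarrow> real) Zs.
        prob_space R \<and>
        prob_space.indep_vars R (\<lambda>_. borel) E UNIV \<and>
        (\<forall>k. distributed R lborel (E k) (\<lambda>u. ennreal (exponential_density 1 u))) \<and>
        prob_space.indep_vars R (\<lambda>_. path_space) Zs UNIV \<and>
        (\<forall>i. distr R path_space (Zs i) = distr M path_space Z) \<and>
        prob_space.indep_set R
          (sets (vimage_algebra (space R) (\<lambda>\<omega> k. E k \<omega>) (PiM UNIV (\<lambda>_. borel))))
          (sets (vimage_algebra (space R) (\<lambda>\<omega> i. Zs i \<omega>) (PiM UNIV (\<lambda>_. path_space)))) \<and>
        distr P (PiM UNIV (\<lambda>_. borel)) (\<lambda>\<omega> (t, i). ennreal (X \<omega> t $ i)) =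
        distr R (PiM UNIV (\<lambda>_. borel))
          (\<lambda>\<omega> (t, j). SUP i. ennreal ((\<Sum>k\<le>i. E k \<omega>) powr (- 1 / \<alpha>) * Zs i \<omega> t $ j)))"

definition alpha_mass :: "real \<Rightarrow> (real ^ 'p \<Rightarrow> real) \<Rightarrow> ennreal" where
  "alpha_mass \<alpha> g = (\<integral>\<^sup>+t. ennreal (g t powr \<alpha>) \<partial>lborel)"

text \<open>\<open>S\<close> is a random variable on \<open>Q\<close> with density \<open>g\<^sup>\<alpha> / c\<close>, where \<open>c = \<integral> g\<^sup>\<alpha>\<close>.\<close>

definition has_alpha_density ::
  "real \<Rightarrow> (real ^ 'p \<Rightarrow> real) \<Rightarrow> 'q measure \<Rightarrow> ('q \<Rightarrow> real ^ 'p) \<Rightarrow> bool" where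
  "has_alpha_density \<alpha> g Q S \<longleftrightarrow>
     prob_space Q \<and> distributed Q lborel S (\<lambda>t. ennreal (g t powr \<alpha>) / alpha_mass \<alpha> g)"

text \<open>The least index, with respect to the order \<open>le\<close>, at which the maximum over \<open>I\<close> is attained.\<close>

definition infargmax :: "('i \<Rightarrow> 'i \<Rightarrow> bool) \<Rightarrow> 'i set \<Rightarrow> ('i \<Rightarrow> real) \<Rightarrow> 'i" where
  "infargmax le I f =
     (THE j. j \<in> I \<and> (\<forall>i\<in>I. f i \<le> f j) \<and> (\<forall>i\<in>I. f i = f j \<longrightarrow> le j i))"

definition lex_le :: "'a::linorder \<times> 'b::linorder \<Rightarrow> 'a \<times> 'b \<Rightarrow> bool" where
  "lex_le u v \<longleftrightarrow> fst u < fst v \<or> fst u = fst v \<and> snd u \<le> snd v"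

definition smith_spectral ::
  "real \<Rightarrow> (real ^ 'p \<Rightarrow> real) \<Rightarrow> (real ^ 'p \<Rightarrow> real ^ 'd) \<Rightarrow> ('m \<Rightarrow> real ^ 'p)
    \<Rightarrow> 'm \<Rightarrow> real ^ 'p \<Rightarrow> real ^ 'd" where
  "smith_spectral \<alpha> p L W = (\<lambda>\<omega> t. (1 / p (W \<omega>)) powr (1 / \<alpha>) *\<^sub>R L (t - W \<omega>))"

end

theory Submission
  imports Defs
begin

text \<open>Since \<open>W\<close> has density \<open>p\<close>, the factor \<open>1 / p (W)\<close> in \<open>Z\<^sup>\<alpha>\<close> turns every expectation of an
  \<open>\<alpha>\<close>-homogeneous functional of \<open>Z\<close> into a Lebesgue integral over the position of \<open>W\<close>; the reflection
  \<open>w = h - s\<close> then gives the tilted laws.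

  For (c), let \<open>V i\<close> be the largest of the numbers \<open>(Z\<^sub>i (t j) / x j)\<^sup>\<alpha>\<close>, so that the event is
  \<open>V i \<le> \<Gamma> i\<close> for all \<open>i\<close>. With \<open>\<psi> s = exp (- \<E> (V - s)\<^sup>+)\<close>, the expectation of
  \<open>\<psi> (\<Gamma> n)\<close> on the event that \<open>V i \<le> \<Gamma> i\<close> for \<open>i \<le> n\<close> does not depend on \<open>n\<close>. As \<open>\<Gamma> n \<rightarrow> \<infinity>\<close> and \<open>\<psi> \<rightarrow> 1\<close>,
  the probability of the event is \<open>\<psi> 0 = exp (- \<E> V)\<close>. Splitting \<open>\<E> V\<close> according to the least index
  at which the maximum is attained, and reflecting around the corresponding time, gives both sums.\<close>

section \<open>Tilted laws\<close>

lemma is_norm_continuous: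
  fixes N :: "'a::euclidean_space \<Rightarrow> real"
  assumes "is_norm N"
  shows "continuous_on UNIV N"
proof (rule convex_on_continuous)
  show "convex_on UNIV N"
  proof (rule convex_onI)
    fix t :: real and x y :: 'a assume t: "0 < t" "t < 1"
    have scale: "N (a *\<^sub>R z) = \<bar>a\<bar> * N z" and add: "N (z + z') \<le> N z + N z'" for a z z'
      using assms by (auto simp: is_norm_def)
    show "N ((1 - t) *\<^sub>R x + t *\<^sub>R y) \<le> (1 - t) * N x + t * N y"
      using add[of "(1 - t) *\<^sub>R x" "t *\<^sub>R y"] t by (simp add: scale)
  qed simp
qed simp

lemma is_norm_equiv:
  fixes N N' :: "'a::euclidean_space \<Rightarrow> real"
  assumes N: "is_norm N" and N': "is_norm N'"
  obtains C where "0 < C" "\<And>x. N x \<le> C * N' x"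
proof -
  have S: "compact (sphere (0::'a) 1)" "sphere (0::'a) 1 \<noteq> {}" by auto
  obtain u where u: "norm u = 1" "\<And>x. norm x = 1 \<Longrightarrow> N x \<le> N u"
    using continuous_attains_sup[OF S continuous_on_subset[OF is_norm_continuous[OF N]]] by auto
  obtain v where v: "norm v = 1" "\<And>x. norm x = 1 \<Longrightarrow> N' v \<le> N' x"
    using continuous_attains_inf[OF S continuous_on_subset[OF is_norm_continuous[OF N']]] by auto
  have "u \<noteq> 0" "v \<noteq> 0" using u v by auto
  then have pos: "0 < N u" "0 < N' v"
    using N N' unfolding is_norm_def by (metis order_le_less)+
  have scale: "N (a *\<^sub>R x) = \<bar>a\<bar> * N x" "N' (a *\<^sub>R x) = \<bar>a\<bar> * N' x" for a x
    using N N' by (auto simp: is_norm_def)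
  show ?thesis
  proof
    show "0 < N u / N' v" using pos by simp
    fix x
    show "N x \<le> N u / N' v * N' x"
    proof (cases "x = 0")
      case True
      then have "N x = 0" "N' x = 0" using N N' by (auto simp: is_norm_def)
      then show ?thesis by simp
    next
      case False
      define y where "y = x /\<^sub>R norm x"
      have y: "norm y = 1" "x = norm x *\<^sub>R y" using False by (simp_all add: y_def)
      have "N y \<le> N u / N' v * N' v" using u(2)[OF y(1)] pos by simp
      also have "\<dots> \<le> N u / N' v * N' y" using v(2)[OF y(1)] pos by (intro mult_left_mono) auto
      finally have "norm x * N y \<le> norm x * (N u / N' v * N' y)" by (rule mult_left_mono) simp
      moreover have "N x = norm x * N y" "N' x = norm x * N' y"
        by (subst y(2), simp add: scale)+
      ultimately show ?thesis by (simp add: mult_ac)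
    qed
  qed
qed

lemma is_norm_infnorm: "is_norm (infnorm :: 'a::euclidean_space \<Rightarrow> real)"
  by (simp add: is_norm_def infnorm_pos_le infnorm_eq_0 infnorm_mul infnorm_triangle)

lemma alpha_mass_mono:
  assumes "0 \<le> \<alpha>" and "0 \<le> C" and "g \<in> borel_measurable borel"
    and "\<And>t. 0 \<le> f t" and "\<And>t. f t \<le> C * g t" and "\<And>t. 0 \<le> g t"
  shows "alpha_mass \<alpha> f \<le> ennreal (C powr \<alpha>) * alpha_mass \<alpha> g"
proof -
  have "alpha_mass \<alpha> f \<le> (\<integral>\<^sup>+t. ennreal (C powr \<alpha>) * ennreal (g t powr \<alpha>) \<partial>lborel)"
    unfolding alpha_mass_def
  proof (intro nn_integral_mono)
    fix t
    have "f t powr \<alpha> \<le> (C * g t) powr \<alpha>" using assms by (intro powr_mono2) auto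
    then show "ennreal (f t powr \<alpha>) \<le> ennreal (C powr \<alpha>) * ennreal (g t powr \<alpha>)"
      using assms by (simp add: powr_mult ennreal_mult[symmetric])
  qed
  also have "\<dots> = ennreal (C powr \<alpha>) * alpha_mass \<alpha> g"
    unfolding alpha_mass_def using assms by (intro nn_integral_cmult) auto
  finally show ?thesis .
qed

lemma space_path_space: "space path_space = cpaths"
  unfolding path_space_def by (intro space_measure_of) auto

lemma measurable_path_space_eval: "(\<lambda>f. f t) \<in> borel_measurable path_space"
proof (rule measurableI)
  fix B :: "(real ^ 'b) set" assume "B \<in> sets borel"
  moreover have "(\<lambda>f. f t) -` B \<inter> space path_space = {f \<in> cpaths. f t \<in> B}"
    by (auto simp: space_path_space)
  ultimately show "(\<lambda>f. f t) -` B \<inter> space path_space \<in> sets path_space"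
    unfolding path_space_def by (auto intro!: sigma_sets.Basic)
qed simp

lemma measurable_path_spaceI:
  fixes X :: "'a \<Rightarrow> real ^ 'p \<Rightarrow> real ^ 'd"
  assumes "\<And>x. x \<in> space M \<Longrightarrow> X x \<in> cpaths"
    and "\<And>t. (\<lambda>x. X x t) \<in> borel_measurable M"
  shows "X \<in> measurable M path_space"
  unfolding path_space_def
proof (rule measurable_sigma_sets[OF sets_measure_of])
  fix A :: "(real ^ 'p \<Rightarrow> real ^ 'd) set"
  assume "A \<in> {{f \<in> cpaths. f t \<in> B} | t B. B \<in> sets borel}"
  then obtain t B where A: "A = {f \<in> cpaths. f t \<in> B}" "B \<in> sets borel" by auto
  then have "X -` A \<inter> space M = (\<lambda>x. X x t) -` B \<inter> space M" using assms(1) by auto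
  then show "X -` A \<inter> space M \<in> sets M" using measurable_sets[OF assms(2) A(2)] by simp
qed (use assms(1) in auto)

lemma measurable_backshift[measurable]: "backshift h \<in> measurable path_space path_space"
proof (rule measurable_path_spaceI)
  fix f :: "real ^ 'a \<Rightarrow> real ^ 'b" assume "f \<in> space path_space"
  then show "backshift h f \<in> cpaths"
    by (auto simp: space_path_space cpaths_def backshift_def
        intro!: continuous_on_compose2[of UNIV f] continuous_intros)
qed (simp add: backshift_def measurable_path_space_eval)

lemma nn_integral_lborel_reflect:
  fixes F :: "'a::euclidean_space \<Rightarrow> ennreal"
  assumes [measurable]: "F \<in> borel_measurable borel"
  shows "(\<integral>\<^sup>+w. F (h - w) \<partial>lborel) = (\<integral>\<^sup>+s. F s \<partial>lborel)"
proof -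
  have "(\<integral>\<^sup>+s. F s \<partial>lborel) = (\<integral>\<^sup>+s. F s \<partial>density (distr lborel borel (\<lambda>x. h + (-1) *\<^sub>R x)) (\<lambda>_. 1))"
    by (subst lborel_affine[of "-1" h]) simp_all
  also have "\<dots> = (\<integral>\<^sup>+w. F (h - w) \<partial>lborel)"
    by (simp add: density_1 nn_integral_distr)
  finally show ?thesis ..
qed

lemma nn_integral_inverse_density:
  assumes W: "distributed M lborel W (\<lambda>t. ennreal (p t))" and p: "\<And>t. 0 < p t"
    and F: "F \<in> borel_measurable borel"
  shows "(\<integral>\<^sup>+\<omega>. ennreal (1 / p (W \<omega>)) * F (W \<omega>) \<partial>M) = (\<integral>\<^sup>+w. F w \<partial>lborel)"
proof -
  have "(\<lambda>t. enn2real (ennreal (p t))) \<in> borel_measurable borel"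
    using distributed_borel_measurable[OF W] by measurable
  then have [measurable]: "p \<in> borel_measurable borel"
    using p by (simp add: less_imp_le)
  note [measurable] = F
  have "(\<integral>\<^sup>+\<omega>. ennreal (1 / p (W \<omega>)) * F (W \<omega>) \<partial>M)
      = (\<integral>\<^sup>+w. ennreal (p w) * (ennreal (1 / p w) * F w) \<partial>lborel)"
    by (rule distributed_nn_integral[OF W, symmetric]) measurable
  also have "\<dots> = (\<integral>\<^sup>+w. F w \<partial>lborel)"
  proof (rule nn_integral_cong)
    fix w
    have "ennreal (p w) * ennreal (1 / p w) = 1"
      using p[of w] by (simp add: ennreal_mult[symmetric])
    then show "ennreal (p w) * (ennreal (1 / p w) * F w) = F w"
      by (simp add: mult.assoc[symmetric])
  qed
  finally show ?thesis .
qed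

lemma tilted_law_smith:
  fixes L :: "real ^ 'p \<Rightarrow> real ^ 'd" and g :: "real ^ 'd \<Rightarrow> real"
  assumes "\<alpha> > 0"
    and L: "continuous_on UNIV L" "\<And>t i. 0 \<le> L t $ i"
    and g: "g \<in> borel_measurable borel" "\<And>c x. 0 < c \<Longrightarrow> g (c *\<^sub>R x) = c * g x" "\<And>t. 0 \<le> g (L t)"
    and W: "distributed M lborel W (\<lambda>t. ennreal (p t))" and p: "\<And>t. 0 < p t"
  defines "\<Psi> \<equiv> \<lambda>h s t. L (t - h + s) /\<^sub>R g (L s)"
  shows "\<Psi> h \<in> measurable borel path_space"
    and "tilted_law \<alpha> g M (smith_spectral \<alpha> p L W) h =
      distr (density lborel (\<lambda>s. ennreal (g (L s) powr \<alpha>) / alpha_mass \<alpha> (\<lambda>t. g (L t)))) path_space (\<Psi> h)"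
proof -
  have [measurable]: "L \<in> borel_measurable borel" using L(1) by (rule borel_measurable_continuous_onI)
  note [measurable] = g(1)
  show \<Psi>[measurable]: "\<Psi> h \<in> measurable borel path_space"
  proof (rule measurable_path_spaceI)
    fix s
    show "\<Psi> h s \<in> cpaths"
      using L(2) g(3) unfolding \<Psi>_def cpaths_def
      by (auto intro!: continuous_intros continuous_on_compose2[OF L(1)])
  qed (simp add: \<Psi>_def)
  let ?Z = "smith_spectral \<alpha> p L W" and ?m = "alpha_mass \<alpha> (\<lambda>t. g (L t))"
  define c where "c \<omega> = (1 / p (W \<omega>)) powr (1 / \<alpha>)" for \<omega>
  have c: "0 < c \<omega>" "c \<omega> powr \<alpha> = 1 / p (W \<omega>)" for \<omega>
    using p[of "W \<omega>"] \<open>\<alpha> > 0\<close> by (simp_all add: c_def powr_powr)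
  have gZ: "g (?Z \<omega> h) = c \<omega> * g (L (h - W \<omega>))" for \<omega>
    using g(2)[OF c(1)] by (simp add: smith_spectral_def c_def)
  have gZp: "ennreal (g (?Z \<omega> h) powr \<alpha>) = ennreal (1 / p (W \<omega>)) * ennreal (g (L (h - W \<omega>)) powr \<alpha>)" for \<omega>
    unfolding gZ using g(3) c(1)[of \<omega>] p[of "W \<omega>"] by (simp add: powr_mult c(2) ennreal_mult[symmetric] less_imp_le)
  have quot: "(\<lambda>t. ?Z \<omega> t /\<^sub>R g (?Z \<omega> h)) = \<Psi> h (h - W \<omega>)" for \<omega>
    using c(1)[of \<omega>] unfolding gZ by (auto simp: \<Psi>_def smith_spectral_def c_def fun_eq_iff)
  have "(\<integral>\<^sup>+\<omega>. ennreal (g (?Z \<omega> h) powr \<alpha>) * F (\<lambda>t. ?Z \<omega> t /\<^sub>R g (?Z \<omega> h)) \<partial>M)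
      = (\<integral>\<^sup>+s. ennreal (g (L s) powr \<alpha>) * F (\<Psi> h s) \<partial>lborel)"
    if [measurable]: "F \<in> borel_measurable path_space" for F
  proof -
    have "(\<integral>\<^sup>+\<omega>. ennreal (g (?Z \<omega> h) powr \<alpha>) * F (\<lambda>t. ?Z \<omega> t /\<^sub>R g (?Z \<omega> h)) \<partial>M)
        = (\<integral>\<^sup>+\<omega>. ennreal (1 / p (W \<omega>)) * (ennreal (g (L (h - W \<omega>)) powr \<alpha>) * F (\<Psi> h (h - W \<omega>))) \<partial>M)"
      unfolding gZp quot by (simp add: mult.assoc)
    also have "\<dots> = (\<integral>\<^sup>+w. ennreal (g (L (h - w)) powr \<alpha>) * F (\<Psi> h (h - w)) \<partial>lborel)"
      by (rule nn_integral_inverse_density[OF W p]) measurable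
    also have "\<dots> = (\<integral>\<^sup>+s. ennreal (g (L s) powr \<alpha>) * F (\<Psi> h s) \<partial>lborel)"
      by (rule nn_integral_lborel_reflect) measurable
    finally show ?thesis .
  qed
  note int = this
  have den: "(\<integral>\<^sup>+\<omega>. ennreal (g (?Z \<omega> h) powr \<alpha>) \<partial>M) = ?m"
    using int[of "\<lambda>_. 1"] by (simp add: alpha_mass_def)
  let ?D = "distr (density lborel (\<lambda>s. ennreal (g (L s) powr \<alpha>) / ?m)) path_space (\<Psi> h)"
  have "tilted_law \<alpha> g M ?Z h = measure_of (space ?D) (sets ?D) (emeasure ?D)"
    unfolding tilted_law_def den space_distr sets_distr
  proof (rule measure_of_eq[OF sets.space_closed])
    fix A :: "(real ^ 'p \<Rightarrow> real ^ 'd) set"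
    assume "A \<in> sigma_sets (space path_space) (sets path_space)"
    then have [measurable]: "A \<in> sets path_space" by (simp add: sets.sigma_sets_eq)
    have ind: "(\<lambda>s. indicator A (\<Psi> h s) :: ennreal) \<in> borel_measurable borel"
      by (rule measurable_compose[OF \<Psi>]) simp
    have "emeasure ?D A = (\<integral>\<^sup>+s. ennreal (g (L s) powr \<alpha>) / ?m * indicator (\<Psi> h -` A) s \<partial>lborel)"
      using measurable_sets_borel[OF \<Psi>] by (simp add: emeasure_distr emeasure_density measurable_sets_borel)
    also have "\<dots> = (\<integral>\<^sup>+s. (ennreal (g (L s) powr \<alpha>) * indicator A (\<Psi> h s)) / ?m \<partial>lborel)"
      by (intro nn_integral_cong) (simp add: indicator_def)
    also have "\<dots> = (\<integral>\<^sup>+s. ennreal (g (L s) powr \<alpha>) * indicator A (\<Psi> h s) \<partial>lborel) / ?m"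
      using ind by (intro nn_integral_divide) simp
    finally show "(\<integral>\<^sup>+\<omega>. ennreal (g (?Z \<omega> h) powr \<alpha>) * indicator A (\<lambda>t. ?Z \<omega> t /\<^sub>R g (?Z \<omega> h)) \<partial>M) / ?m
      = emeasure ?D A"
      by (simp add: int)
  qed
  then show "tilted_law \<alpha> g M ?Z h = ?D" by (simp only: measure_of_of_measure)
qed

lemma distr_has_alpha_density:
  assumes "has_alpha_density \<alpha> g Q S" and [measurable]: "\<Psi> \<in> measurable borel N"
  shows "distr Q N (\<lambda>\<omega>. \<Psi> (S \<omega>)) = distr (density lborel (\<lambda>s. ennreal (g s powr \<alpha>) / alpha_mass \<alpha> g)) N \<Psi>"
proof -
  have S: "distributed Q lborel S (\<lambda>s. ennreal (g s powr \<alpha>) / alpha_mass \<alpha> g)"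
    using assms(1) by (simp add: has_alpha_density_def)
  then have [measurable]: "S \<in> measurable Q borel" by (simp add: distributed_def)
  show ?thesis
    unfolding distributed_distr_eq_density[OF S, symmetric]
    by (subst distr_distr) (auto simp: comp_def)
qed

section \<open>Void probabilities of marked arrivals\<close>

text \<open>Replaces the fundamental theorem of calculus, which is not available here because \<open>cdf M\<close> may
  be discontinuous.\<close>

lemma const_if_small_increments:
  fixes \<phi> U :: "real \<Rightarrow> real"
  assumes "c \<le> d"
    and incr: "\<And>a b. c \<le> a \<Longrightarrow> a \<le> b \<Longrightarrow> b \<le> d \<Longrightarrow> \<bar>\<phi> b - \<phi> a\<bar> \<le> (b - a) * (U b - U a)"
  shows "\<phi> d = \<phi> c"
proof -
  have le: "real m * \<bar>\<phi> d - \<phi> c\<bar> \<le> (d - c) * (U d - U c)" if m: "m > 0" for m :: nat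
  proof -
    define q where "q i = c + real i * ((d - c) / m)" for i
    have q: "q 0 = c" "q m = d" "\<And>i. q (Suc i) - q i = (d - c) / m"
      using m by (auto simp: q_def field_simps)
    have mono: "mono q"
      using \<open>c \<le> d\<close> by (intro monoI) (auto simp: q_def intro!: mult_right_mono divide_right_mono)
    have "\<bar>\<phi> d - \<phi> c\<bar> = \<bar>\<Sum>i<m. \<phi> (q (Suc i)) - \<phi> (q i)\<bar>"
      by (subst sum_lessThan_telescope) (simp add: q)
    also have "\<dots> \<le> (\<Sum>i<m. \<bar>\<phi> (q (Suc i)) - \<phi> (q i)\<bar>)" by (rule sum_abs)
    also have "\<dots> \<le> (\<Sum>i<m. (d - c) / m * (U (q (Suc i)) - U (q i)))"
    proof (intro sum_mono)
      fix i assume "i \<in> {..<m}"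
      then have "q 0 \<le> q i" "q i \<le> q (Suc i)" "q (Suc i) \<le> q m"
        using mono by (auto intro!: monoD[OF mono])
      then show "\<bar>\<phi> (q (Suc i)) - \<phi> (q i)\<bar> \<le> (d - c) / m * (U (q (Suc i)) - U (q i))"
        using incr[of "q i" "q (Suc i)"] q by simp
    qed
    also have "\<dots> = (d - c) / m * (U d - U c)"
      unfolding sum_distrib_left[symmetric] by (subst sum_lessThan_telescope) (simp add: q)
    finally show ?thesis using m by (simp add: field_simps)
  qed
  show ?thesis
  proof (rule ccontr)
    assume "\<phi> d \<noteq> \<phi> c"
    then obtain m :: nat where m: "(d - c) * (U d - U c) < m * \<bar>\<phi> d - \<phi> c\<bar>"
      using ex_less_of_nat_mult[of "\<bar>\<phi> d - \<phi> c\<bar>"] by auto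
    also have "\<dots> \<le> Suc m * \<bar>\<phi> d - \<phi> c\<bar>" by (intro mult_right_mono) auto
    finally show False using le[of "Suc m"] by simp
  qed
qed

definition mean_max :: "real measure \<Rightarrow> real \<Rightarrow> real" where
  "mean_max D y = (LINT v|D. max v y)"

context real_distribution
begin

lemma mean_max_increment:
  assumes [simp]: "integrable M (\<lambda>v. v)" and "a \<le> b"
  shows "(b - a) * cdf M a \<le> mean_max M b - mean_max M a"
    and "mean_max M b - mean_max M a \<le> (b - a) * cdf M b"
proof -
  have *: "mean_max M b - mean_max M a = (LINT v|M. max v b - max v a)"
    unfolding mean_max_def by (intro Bochner_Integration.integral_diff[symmetric]) auto
  have "(LINT v|M. (b - a) * indicator {..c} v) = (b - a) * cdf M c" for c
    by (simp add: cdf_def)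
  moreover have "(LINT v|M. (b - a) * indicator {..a} v) \<le> (LINT v|M. max v b - max v a)"
    using \<open>a \<le> b\<close> by (intro integral_mono integrable_mult_right integrable_real_indicator) (auto simp: indicator_def emeasure_eq_measure)
  moreover have "(LINT v|M. max v b - max v a) \<le> (LINT v|M. (b - a) * indicator {..b} v)"
    using \<open>a \<le> b\<close> by (intro integral_mono integrable_mult_right integrable_real_indicator) (auto simp: indicator_def emeasure_eq_measure)
  ultimately show "(b - a) * cdf M a \<le> mean_max M b - mean_max M a"
    "mean_max M b - mean_max M a \<le> (b - a) * cdf M b"
    by (simp_all add: * cdf_def)
qed

lemma mono_mean_max: "integrable M (\<lambda>v. v) \<Longrightarrow> mono (mean_max M)"
  unfolding mean_max_def
  by (intro monoI integral_mono) auto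

lemma mean_max_ge: "integrable M (\<lambda>v. v) \<Longrightarrow> y \<le> mean_max M y"
  unfolding mean_max_def using integral_mono[of M "\<lambda>_. y" "\<lambda>v. max v y"] by (simp add: prob_space[simplified])

lemma mean_max_measurable[measurable]:
  "integrable M (\<lambda>v. v) \<Longrightarrow> mean_max M \<in> borel_measurable borel"
  by (intro borel_measurable_mono mono_mean_max)

lemma cdf_measurable[measurable]: "cdf M \<in> borel_measurable borel"
  by (intro borel_measurable_mono monoI cdf_nondecreasing)

lemma exp_mean_max_eq_integral:
  assumes int: "integrable M (\<lambda>v. v)"
  shows "set_integrable lborel {s..} (\<lambda>u. cdf M u * exp (- mean_max M u))" (is ?T1)
    and "(LINT u:{s..}|lborel. cdf M u * exp (- mean_max M u)) = exp (- mean_max M s)" (is ?T2)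
proof -
  note [measurable] = mean_max_measurable[OF int]
  define K f I where "K = mean_max M" and "f = (\<lambda>u. cdf M u * exp (- K u))"
    and "I s = (LINT u:{s..}|lborel. f u)" for s
  have [measurable]: "K \<in> borel_measurable borel" "f \<in> borel_measurable borel"
    unfolding K_def f_def by measurable
  have f_nonneg: "0 \<le> f u" for u by (simp add: f_def cdf_nonneg)
  have f_le: "f u \<le> exp (- u)" for u
    unfolding f_def K_def
    using mult_mono[of "cdf M u" 1 "exp (- mean_max M u)" "exp (- u)"] mean_max_ge[OF int, of u]
    by (simp add: cdf_bounded_prob)
  have expI: "set_integrable lborel {s..} (\<lambda>u. exp (- u))"
    "(LINT u:{s..}|lborel. exp (- u)) = exp (- s)" for s :: real
  proof -
    have nn: "(\<integral>\<^sup>+u. ennreal (indicator {s..} u * exp (- u)) \<partial>lborel) = ennreal (exp (- s))"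
      using nn_integral_has_integral_lebesgue[OF _ has_integral_exp_minus_to_infinity[of 1 s]] by simp
    have "integrable lborel (\<lambda>u. indicator {s..} u * exp (- u))"
      by (rule integrableI_nn_integral_finite[OF _ _ nn]) auto
    then show "set_integrable lborel {s..} (\<lambda>u. exp (- u))" by (simp add: set_integrable_def)
    show "(LINT u:{s..}|lborel. exp (- u)) = exp (- s)"
      unfolding set_lebesgue_integral_def using nn by (subst integral_eq_nn_integral) auto
  qed
  have fI: "set_integrable lborel {s..} f" for s
    by (rule set_integrable_bound[OF expI(1)[of s]])
       (use f_le f_nonneg in \<open>auto simp: set_borel_measurable_def\<close>)
  show ?T1 using fI[of s] by (simp add: f_def K_def)
  have I_nonneg: "0 \<le> I s" for s
    unfolding I_def set_lebesgue_integral_def by (intro Bochner_Integration.integral_nonneg) (auto simp: f_nonneg)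
  have I_le: "I s \<le> exp (- s)" for s
    unfolding I_def expI(2)[of s, symmetric] by (intro set_integral_mono fI expI f_le)
  have I_incr: "(b - a) * cdf M a * exp (- K b) \<le> I a - I b \<and> I a - I b \<le> (b - a) * cdf M b * exp (- K a)"
    if "a \<le> b" for a b
  proof -
    have ab: "set_integrable lborel {a..<b} f" by (rule set_integrable_subset[OF fI[of a]]) auto
    have "{a..} = {a..<b} \<union> {b..}" "{a..<b} \<inter> {b..} = {}" using that by auto
    then have *: "I a - I b = (LINT u:{a..<b}|lborel. f u)"
      unfolding I_def using set_integral_Un[OF _ ab fI[of b]] by simp
    have c: "(LINT u:{a..<b}|lborel. c) = (b - a) * c" for c :: real
      using that by (simp add: set_lebesgue_integral_def)
    have ci: "set_integrable lborel {a..<b} (\<lambda>u. c)" for c :: real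
      using that unfolding set_integrable_def by auto
    have "cdf M a * exp (- K b) \<le> f u \<and> f u \<le> cdf M b * exp (- K a)" if "u \<in> {a..<b}" for u
      unfolding f_def using that monoD[OF mono_mean_max[OF int]]
      by (auto simp: K_def intro!: mult_mono cdf_nondecreasing cdf_nonneg)
    then have "(LINT u:{a..<b}|lborel. cdf M a * exp (- K b)) \<le> (LINT u:{a..<b}|lborel. f u)"
      "(LINT u:{a..<b}|lborel. f u) \<le> (LINT u:{a..<b}|lborel. cdf M b * exp (- K a))"
      by (intro set_integral_mono ab ci; blast)+
    then show ?thesis unfolding * c by (simp add: mult_ac)
  qed
  have E_incr: "(b - a) * cdf M a * exp (- K b) \<le> exp (- K a) - exp (- K b)
      \<and> exp (- K a) - exp (- K b) \<le> (b - a) * cdf M b * exp (- K a)"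
    if "a \<le> b" for a b
  proof
    note inc = mean_max_increment[OF int that, folded K_def]
    have "(b - a) * cdf M a * exp (- K b) \<le> (K b - K a) * exp (- K b)"
      using inc(1) by (intro mult_right_mono) auto
    also have "\<dots> \<le> (exp (K b - K a) - 1) * exp (- K b)"
      using exp_ge_add_one_self[of "K b - K a"]
      by (intro mult_right_mono) (simp_all add: algebra_simps del: exp_ge_add_one_self)
    also have "\<dots> = exp (- K a) - exp (- K b)" by (simp add: left_diff_distrib exp_add[symmetric])
    finally show "(b - a) * cdf M a * exp (- K b) \<le> exp (- K a) - exp (- K b)" .
    have "exp (- K a) - exp (- K b) = (1 - exp (- (K b - K a))) * exp (- K a)"
      by (simp add: left_diff_distrib exp_add[symmetric])
    also have "\<dots> \<le> (K b - K a) * exp (- K a)"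
      using exp_ge_add_one_self[of "- (K b - K a)"]
      by (intro mult_right_mono) (simp_all add: algebra_simps del: exp_ge_add_one_self)
    also have "\<dots> \<le> (b - a) * cdf M b * exp (- K a)"
      using inc(2) by (intro mult_right_mono) auto
    finally show "exp (- K a) - exp (- K b) \<le> (b - a) * cdf M b * exp (- K a)" .
  qed
  have const: "I d - exp (- K d) = I s - exp (- K s)" if "s \<le> d" for d
  proof (rule const_if_small_increments[OF that, where U="\<lambda>u. exp (- s) * cdf M u - exp (- K u)"])
    fix a b assume ab: "s \<le> a" "a \<le> b" "b \<le> d"
    have Ka: "exp (- K a) \<le> exp (- s)"
      using ab mean_max_ge[OF int, of a] by (simp add: K_def)
    have "cdf M b * exp (- K a) - cdf M a * exp (- K b)
        = (cdf M b - cdf M a) * exp (- K a) + cdf M a * (exp (- K a) - exp (- K b))"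
      by (simp add: algebra_simps)
    also have "\<dots> \<le> (cdf M b - cdf M a) * exp (- s) + 1 * (exp (- K a) - exp (- K b))"
      using ab Ka monoD[OF mono_mean_max[OF int], folded K_def]
      by (intro add_mono mult_mono) (auto simp: cdf_bounded_prob cdf_nondecreasing)
    finally have "(b - a) * (cdf M b * exp (- K a) - cdf M a * exp (- K b))
        \<le> (b - a) * ((cdf M b - cdf M a) * exp (- s) + 1 * (exp (- K a) - exp (- K b)))"
      using ab by (intro mult_left_mono) auto
    then show "\<bar>I b - exp (- K b) - (I a - exp (- K a))\<bar>
        \<le> (b - a) * (exp (- s) * cdf M b - exp (- K b) - (exp (- s) * cdf M a - exp (- K a)))"
      using I_incr[OF ab(2), THEN conjunct1] I_incr[OF ab(2), THEN conjunct2]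
        E_incr[OF ab(2), THEN conjunct1] E_incr[OF ab(2), THEN conjunct2]
      by (intro abs_leI) (simp_all add: algebra_simps)
  qed
  have "(\<lambda>d. I (real d) - exp (- K (real d))) \<longlonglongrightarrow> 0 - 0"
  proof (intro tendsto_diff)
    have ex: "(\<lambda>d. exp (- real d)) \<longlonglongrightarrow> 0" by real_asymp
    show "(\<lambda>d. I (real d)) \<longlonglongrightarrow> 0"
      by (rule tendsto_sandwich[OF _ _ tendsto_const ex]) (auto simp: I_nonneg I_le)
    show "(\<lambda>d. exp (- K (real d))) \<longlonglongrightarrow> 0"
      by (rule tendsto_sandwich[OF _ _ tendsto_const ex]) (auto simp: K_def mean_max_ge[OF int])
  qed
  moreover have "(\<lambda>d. I (real d) - exp (- K (real d))) \<longlonglongrightarrow> I s - exp (- K s)"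
    by (rule tendsto_eventually, rule eventually_mono[OF eventually_ge_at_top[of "nat \<lceil>s\<rceil>"]])
       (intro const, linarith)
  ultimately have "I s - exp (- K s) = 0 - 0" by (rule LIMSEQ_unique[rotated])
  then show ?T2 by (simp add: I_def K_def f_def)
qed

end

context real_distribution
begin

text \<open>Heuristically the probability that \<open>V i \<le> s + \<Gamma> i\<close> for all \<open>i\<close>, where the \<open>V i\<close> have law
  \<open>M\<close>. It is a fixed point of the one-step transition to \<open>s + E 0\<close>.\<close>

definition void_weight :: "real \<Rightarrow> real" where
  "void_weight s = exp (s - mean_max M s)"

lemma void_weight_pos: "0 < void_weight s"
  by (simp add: void_weight_def)

lemma void_weight_le_1: "integrable M (\<lambda>v. v) \<Longrightarrow> void_weight s \<le> 1"
  using mean_max_ge[of s] by (simp add: void_weight_def)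

lemma mono_void_weight:
  assumes "integrable M (\<lambda>v. v)"
  shows "mono void_weight"
proof (intro monoI)
  fix a b :: real assume "a \<le> b"
  then have "mean_max M b - mean_max M a \<le> (b - a) * 1"
    by (intro order_trans[OF mean_max_increment(2)[OF assms]] mult_left_mono cdf_bounded_prob) simp_all
  then show "void_weight a \<le> void_weight b" by (simp add: void_weight_def)
qed

lemma void_weight_measurable[measurable]:
  "integrable M (\<lambda>v. v) \<Longrightarrow> void_weight \<in> borel_measurable borel"
  by (intro borel_measurable_mono mono_void_weight)

lemma void_weight_tendsto_1:
  assumes int: "integrable M (\<lambda>v. v)"
  shows "(\<lambda>n. void_weight (real n)) \<longlonglongrightarrow> 1"
proof -
  have "(\<lambda>n. LINT v|M. max v (real n) - real n) \<longlonglongrightarrow> (LINT v|M. 0)"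
  proof (rule integral_dominated_convergence[where w="\<lambda>v. \<bar>v\<bar>"])
    show "AE v in M. (\<lambda>n. max v (real n) - real n) \<longlonglongrightarrow> 0"
    proof (intro AE_I2 tendsto_eventually)
      show "\<forall>\<^sub>F n in sequentially. max v (real n) - real n = 0" for v
        using eventually_ge_at_top[of "nat \<lceil>v\<rceil>"] by eventually_elim linarith
    qed
    show "AE v in M. norm (max v (real n) - real n) \<le> \<bar>v\<bar>" for n
      by (intro AE_I2) simp
    show "integrable M (\<lambda>v. \<bar>v\<bar>)" using int by simp
  qed measurable
  moreover have "(LINT v|M. max v (real n) - real n) = mean_max M n - n" for n
    unfolding mean_max_def using int
    by (subst Bochner_Integration.integral_diff) (simp_all add: prob_space[simplified])
  ultimately have "(\<lambda>n. mean_max M (real n) - real n) \<longlonglongrightarrow> 0" by simp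
  then have "(\<lambda>n. exp (- (mean_max M (real n) - real n))) \<longlonglongrightarrow> exp (- 0)"
    by (intro tendsto_intros)
  then show ?thesis by (simp add: void_weight_def)
qed

lemma nn_integral_void_weight_step:
  assumes int: "integrable M (\<lambda>v. v)"
  shows "(\<integral>\<^sup>+y. ennreal (cdf M (s + y)) * ennreal (void_weight (s + y))
      \<partial>density lborel (exponential_density 1)) = ennreal (void_weight s)"
proof -
  note [measurable] = mean_max_measurable[OF int] void_weight_measurable[OF int]
  define f where "f u = cdf M u * exp (- mean_max M u)" for u
  have [measurable]: "f \<in> borel_measurable borel" unfolding f_def by measurable
  have f_nonneg: "0 \<le> f u" for u by (simp add: f_def cdf_nonneg)
  have "(\<integral>\<^sup>+y. ennreal (cdf M (s + y)) * ennreal (void_weight (s + y))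
      \<partial>density lborel (exponential_density 1)) =
    (\<integral>\<^sup>+y. ennreal (exponential_density 1 y) * (ennreal (cdf M (s + y)) * ennreal (void_weight (s + y))) \<partial>lborel)"
    by (subst nn_integral_density) auto
  also have "\<dots> = (\<integral>\<^sup>+y. ennreal (exp s) * ennreal (indicator {s..} (s + y) * f (s + y)) \<partial>lborel)"
  proof (intro nn_integral_cong)
    fix y :: real
    show "ennreal (exponential_density 1 y) * (ennreal (cdf M (s + y)) * ennreal (void_weight (s + y)))
      = ennreal (exp s) * ennreal (indicator {s..} (s + y) * f (s + y))"
    proof (cases "0 \<le> y")
      case True
      have "exp (- y) * (cdf M (s + y) * exp (s + y - mean_max M (s + y)))
          = exp s * (cdf M (s + y) * exp (- mean_max M (s + y)))"
        by (simp add: exp_add[symmetric] mult.left_commute)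
      then show ?thesis
        using True by (simp add: exponential_density_def void_weight_def f_def cdf_nonneg
            ennreal_mult[symmetric])
    qed (simp add: exponential_density_def)
  qed
  also have "\<dots> = ennreal (exp s) * (\<integral>\<^sup>+y. ennreal (indicator {s..} (s + y) * f (s + y)) \<partial>lborel)"
    by (rule nn_integral_cmult) auto
  also have "(\<integral>\<^sup>+y. ennreal (indicator {s..} (s + y) * f (s + y)) \<partial>lborel)
      = (\<integral>\<^sup>+u. ennreal (indicator {s..} u * f u) \<partial>distr lborel borel ((+) s))"
    by (subst nn_integral_distr) auto
  also have "\<dots> = (\<integral>\<^sup>+u. ennreal (indicator {s..} u * f u) \<partial>lborel)"
    by (simp add: lborel_distr_plus)
  also have "\<dots> = ennreal (exp (- mean_max M s))"
    using exp_mean_max_eq_integral[OF int, of s] f_nonneg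
    by (subst nn_integral_eq_integral) (auto simp: set_integrable_def set_lebesgue_integral_def f_def)
  finally show ?thesis
    by (simp add: void_weight_def ennreal_mult[symmetric] exp_add[symmetric])
qed

lemma nn_integral_void_weight_arrivals:
  fixes n :: nat
  assumes int: "integrable M (\<lambda>v. v)"
  shows "(\<integral>\<^sup>+e. (\<Prod>i<n. ennreal (cdf M (\<Sum>k\<le>i. e k))) * ennreal (void_weight (\<Sum>k<n. e k))
      \<partial>PiM {..<n} (\<lambda>_. density lborel (exponential_density 1))) = ennreal (void_weight 0)"
proof -
  note [measurable] = mean_max_measurable[OF int] void_weight_measurable[OF int]
  let ?X = "density lborel (exponential_density 1)"
  interpret X: prob_space ?X by (rule prob_space_exponential_density) simp
  interpret product_sigma_finite "\<lambda>_::nat. ?X"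
    by (simp add: product_sigma_finite_def X.sigma_finite_measure_axioms)
  show ?thesis
  proof (induction n)
    case 0
    then show ?case by (simp add: PiM_empty nn_integral_count_space_finite)
  next
    case (Suc n)
    let ?f = "\<lambda>n e. (\<Prod>i<n. ennreal (cdf M (\<Sum>k\<le>i. e k))) * ennreal (void_weight (\<Sum>k<n. e k))"
    have meas: "?f m \<in> borel_measurable (PiM {..<m} (\<lambda>_. ?X))" for m :: nat
    proof -
      have s: "(\<lambda>e. sum e A) \<in> borel_measurable (PiM {..<m} (\<lambda>_. ?X))" if "A \<subseteq> {..<m}" for A
        using that by (intro borel_measurable_sum)
          (auto intro!: measurable_component_singleton[of _ "{..<m}" "\<lambda>_. ?X", simplified])
      show ?thesis
        by (intro borel_measurable_times_ennreal borel_measurable_prod_ennreal measurable_compose[OF s]) auto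
    qed
    have "integral\<^sup>N (PiM {..<Suc n} (\<lambda>_. ?X)) (?f (Suc n))
        = (\<integral>\<^sup>+x. \<integral>\<^sup>+y. ?f (Suc n) (x(n := y)) \<partial>?X \<partial>PiM {..<n} (\<lambda>_. ?X))"
      unfolding lessThan_Suc
      by (rule product_nn_integral_insert[OF _ _ meas[of "Suc n", unfolded lessThan_Suc]]) simp_all
    also have "\<dots> = (\<integral>\<^sup>+x. \<integral>\<^sup>+y. (\<Prod>i<n. ennreal (cdf M (\<Sum>k\<le>i. x k))) *
        (ennreal (cdf M ((\<Sum>k<n. x k) + y)) * ennreal (void_weight ((\<Sum>k<n. x k) + y)))
        \<partial>?X \<partial>PiM {..<n} (\<lambda>_. ?X))"
    proof (intro nn_integral_cong)
      fix x :: "nat \<Rightarrow> real" and y :: real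
      have 1: "(\<Sum>k\<le>i. (x(n := y)) k) = (\<Sum>k\<le>i. x k)" if "i < n" for i
        using that by (intro sum.cong) auto
      have 2: "(\<Sum>k\<le>n. (x(n := y)) k) = (\<Sum>k<n. x k) + y"
        "(\<Sum>k<Suc n. (x(n := y)) k) = (\<Sum>k<n. x k) + y"
        unfolding lessThan_Suc_atMost[symmetric] sum.lessThan_Suc
        by (auto intro!: sum.cong)
      have 3: "(\<Prod>i<Suc n. ennreal (cdf M (\<Sum>k\<le>i. (x(n := y)) k)))
        = (\<Prod>i<n. ennreal (cdf M (\<Sum>k\<le>i. x k))) * ennreal (cdf M ((\<Sum>k<n. x k) + y))"
        unfolding prod.lessThan_Suc 2 using 1 by (intro arg_cong2[where f="(*)"] prod.cong) auto
      show "?f (Suc n) (x(n := y)) = (\<Prod>i<n. ennreal (cdf M (\<Sum>k\<le>i. x k))) *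
        (ennreal (cdf M ((\<Sum>k<n. x k) + y)) * ennreal (void_weight ((\<Sum>k<n. x k) + y)))"
        unfolding 3 2 by (rule mult.assoc)
    qed
    also have "\<dots> = integral\<^sup>N (PiM {..<n} (\<lambda>_. ?X)) (?f n)"
    proof (intro nn_integral_cong)
      fix x :: "nat \<Rightarrow> real"
      have "(\<lambda>y. ennreal (cdf M ((\<Sum>k<n. x k) + y)) * ennreal (void_weight ((\<Sum>k<n. x k) + y)))
        \<in> borel_measurable ?X" by measurable
      then show "(\<integral>\<^sup>+y. (\<Prod>i<n. ennreal (cdf M (\<Sum>k\<le>i. x k))) *
        (ennreal (cdf M ((\<Sum>k<n. x k) + y)) * ennreal (void_weight ((\<Sum>k<n. x k) + y))) \<partial>?X) = ?f n x"
        by (subst nn_integral_cmult) (simp_all only: nn_integral_void_weight_step[OF int])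
    qed
    finally show ?case using Suc by simp
  qed
qed

end

lemma (in prob_space) nn_integral_exp_neg_arrival:
  fixes E :: "nat \<Rightarrow> 'a \<Rightarrow> real"
  assumes E: "indep_vars (\<lambda>_. borel) E UNIV"
    and dE: "\<And>k. distributed M lborel (E k) (exponential_density 1)"
  shows "(\<integral>\<^sup>+\<omega>. ennreal (exp (- (\<Sum>k<n. E k \<omega>))) \<partial>M) = ennreal ((1 / 2) ^ n)"
proof -
  have half: "(\<integral>\<^sup>+\<omega>. ennreal (exp (- E k \<omega>)) \<partial>M) = ennreal (1 / 2)" for k
  proof -
    have "(\<integral>\<^sup>+\<omega>. ennreal (exp (- E k \<omega>)) \<partial>M)
        = (\<integral>\<^sup>+y. ennreal (exponential_density 1 y) * ennreal (exp (- y)) \<partial>lborel)"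
      by (rule distributed_nn_integral[OF dE, symmetric]) simp
    also have "\<dots> = (\<integral>\<^sup>+y. ennreal (indicator {0..} y * exp (- 2 * y)) \<partial>lborel)"
      by (intro nn_integral_cong)
         (auto simp: exponential_density_def ennreal_mult[symmetric] exp_add[symmetric] indicator_def)
    also have "\<dots> = ennreal (1 / 2)"
      using nn_integral_has_integral_lebesgue[OF _ has_integral_exp_minus_to_infinity[of 2 0]] by simp
    finally show ?thesis .
  qed
  have "(\<integral>\<^sup>+\<omega>. ennreal (exp (- (\<Sum>k<n. E k \<omega>))) \<partial>M) = (\<integral>\<^sup>+\<omega>. (\<Prod>k<n. ennreal (exp (- E k \<omega>))) \<partial>M)"
    by (simp add: prod_ennreal exp_sum sum_negf[symmetric])
  also have "\<dots> = (\<Prod>k<n. \<integral>\<^sup>+\<omega>. ennreal (exp (- E k \<omega>)) \<partial>M)"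
    by (intro indep_vars_nn_integral indep_vars_subset[OF indep_vars_compose2[OF E, where Y="\<lambda>_ y. ennreal (exp (- y))"]]) auto
  also have "\<dots> = ennreal ((1 / 2) ^ n)"
    unfolding half prod_constant card_lessThan by (rule ennreal_power) simp
  finally show ?thesis .
qed

lemma (in prob_space) prob_arrivals_dominate_finite:
  fixes E V :: "nat \<Rightarrow> 'a \<Rightarrow> real"
  assumes V: "indep_vars (\<lambda>_. borel) V UNIV"
    and dV: "\<And>i. distr M borel (V i) = D"
    and EV: "indep_var (PiM UNIV (\<lambda>_. borel)) (\<lambda>\<omega> k. E k \<omega>) (PiM UNIV (\<lambda>_. borel)) (\<lambda>\<omega> i. V i \<omega>)"
  shows "emeasure M {\<omega> \<in> space M. \<forall>i<n. V i \<omega> \<le> (\<Sum>k\<le>i. E k \<omega>)}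
    = (\<integral>\<^sup>+\<omega>. (\<Prod>i<n. ennreal (cdf D (\<Sum>k\<le>i. E k \<omega>))) \<partial>M)"
proof -
  let ?N = "PiM UNIV (\<lambda>_. borel) :: (nat \<Rightarrow> real) measure"
  let ?E = "\<lambda>\<omega> k. E k \<omega>" and ?V = "\<lambda>\<omega> k. V k \<omega>"
  let ?B = "{p \<in> space (?N \<Otimes>\<^sub>M ?N). \<forall>i<n. snd p i \<le> (\<Sum>k\<le>i. fst p k)}"
  note EV' = EV[unfolded indep_var_distribution_eq]
  have mE: "?E \<in> measurable M ?N" and mV: "?V \<in> measurable M ?N" using EV' by auto
  have mp: "(\<lambda>\<omega>. (?E \<omega>, ?V \<omega>)) \<in> measurable M (?N \<Otimes>\<^sub>M ?N)"
    by (rule measurable_Pair[OF mE mV])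
  have [measurable]: "random_variable borel (V i)" for i using V by (auto simp: indep_vars_def)
  interpret D: real_distribution D unfolding dV[of 0, symmetric] by simp
  interpret VD: prob_space "distr M ?N ?V" by (rule prob_space_distr[OF mV])
  have B: "?B \<in> sets (?N \<Otimes>\<^sub>M ?N)"
  proof -
    have c[measurable]: "(\<lambda>x. x k) \<in> borel_measurable ?N" for k
      by (rule measurable_component_singleton) simp
    have [measurable]: "(\<lambda>p. fst p k) \<in> borel_measurable (?N \<Otimes>\<^sub>M ?N)"
      "(\<lambda>p. snd p k) \<in> borel_measurable (?N \<Otimes>\<^sub>M ?N)" for k
      by (rule measurable_compose[OF measurable_fst c] measurable_compose[OF measurable_snd c])+
    show ?thesis by (intro predE pred_intros_finite) measurable
  qed
  have finite_V: "emeasure M {\<omega> \<in> space M. \<forall>i<n. V i \<omega> \<le> c i} = (\<Prod>i<n. ennreal (cdf D (c i)))" for c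
  proof (cases "n = 0")
    case False
    have "{\<omega> \<in> space M. \<forall>i<n. V i \<omega> \<le> c i} = (\<Inter>i<n. V i -` {..c i} \<inter> space M)"
      using False by auto
    moreover have "prob (V i -` {..c i} \<inter> space M) = cdf D (c i)" for i
      by (simp add: dV[of i, symmetric] cdf_def measure_distr)
    ultimately show ?thesis
      using indep_varsD[OF V, of "{..<n}" "\<lambda>i. {..c i}"] False
      by (simp add: emeasure_eq_measure prod_ennreal cdf_def lessThan_empty_iff)
  qed (simp add: emeasure_space_1)
  have "emeasure M {\<omega> \<in> space M. \<forall>i<n. V i \<omega> \<le> (\<Sum>k\<le>i. E k \<omega>)}
      = emeasure (distr M (?N \<Otimes>\<^sub>M ?N) (\<lambda>\<omega>. (?E \<omega>, ?V \<omega>))) ?B"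
    by (subst emeasure_distr[OF mp B]) (auto intro!: arg_cong[where f="emeasure M"] simp: space_pair_measure space_PiM)
  also have "\<dots> = emeasure (distr M ?N ?E \<Otimes>\<^sub>M distr M ?N ?V) ?B"
    using EV' by simp
  also have "\<dots> = (\<integral>\<^sup>+e. emeasure (distr M ?N ?V) (Pair e -` ?B) \<partial>distr M ?N ?E)"
    using B by (intro VD.emeasure_pair_measure_alt)
      (simp only: sets_distr sets_pair_measure_cong[OF sets_distr sets_distr])
  also have "\<dots> = (\<integral>\<^sup>+\<omega>. emeasure (distr M ?N ?V) (Pair (?E \<omega>) -` ?B) \<partial>M)"
    using B by (intro nn_integral_distr[OF mE] VD.measurable_emeasure_Pair)
      (simp only: sets_pair_measure_cong[OF sets_distr sets_distr])
  also have "\<dots> = (\<integral>\<^sup>+\<omega>. (\<Prod>i<n. ennreal (cdf D (\<Sum>k\<le>i. E k \<omega>))) \<partial>M)"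
  proof (intro nn_integral_cong)
    fix \<omega> assume "\<omega> \<in> space M"
    have "emeasure (distr M ?N ?V) (Pair (?E \<omega>) -` ?B)
        = emeasure M {\<omega>' \<in> space M. \<forall>i<n. V i \<omega>' \<le> (\<Sum>k\<le>i. E k \<omega>)}"
      by (subst emeasure_distr[OF mV sets_Pair1[OF B]])
        (auto intro!: arg_cong[where f="emeasure M"] simp: space_pair_measure space_PiM)
    then show "emeasure (distr M ?N ?V) (Pair (?E \<omega>) -` ?B) = (\<Prod>i<n. ennreal (cdf D (\<Sum>k\<le>i. E k \<omega>)))"
      by (simp add: finite_V)
  qed
  finally show ?thesis .
qed

lemma (in prob_space) nn_integral_void_weight_indep:
  fixes E :: "nat \<Rightarrow> 'a \<Rightarrow> real"
  assumes E: "indep_vars (\<lambda>_. borel) E UNIV"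
    and dE: "\<And>k. distributed M lborel (E k) (exponential_density 1)"
    and D: "real_distribution D" and int: "integrable D (\<lambda>v. v)"
  shows "(\<integral>\<^sup>+\<omega>. (\<Prod>i<n. ennreal (cdf D (\<Sum>k\<le>i. E k \<omega>)))
      * ennreal (real_distribution.void_weight D (\<Sum>k<n. E k \<omega>)) \<partial>M) = ennreal (real_distribution.void_weight D 0)"
proof (cases "n = 0")
  case False
  interpret D: real_distribution D by fact
  let ?X = "density lborel (exponential_density 1)"
  let ?f = "\<lambda>e. (\<Prod>i<n. ennreal (cdf D (\<Sum>k\<le>i. e k))) * ennreal (D.void_weight (\<Sum>k<n. e k))"
  have [measurable]: "random_variable borel (E k)" for k using E by (auto simp: indep_vars_def)
  have X: "distr M borel (E k) = ?X" for k
    using dE[of k] by (auto simp: distributed_def cong: distr_cong)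
  have s: "(\<lambda>e. sum e A :: real) \<in> borel_measurable (PiM {..<n} (\<lambda>_. borel))"
    if "A \<subseteq> {..<n}" for A :: "nat set"
    using that by (intro borel_measurable_sum)
      (auto intro!: measurable_component_singleton[of _ "{..<n}" "\<lambda>_. borel", simplified])
  have meas: "?f \<in> borel_measurable (PiM {..<n} (\<lambda>_. borel))"
    using D.void_weight_measurable[OF int]
    by (intro borel_measurable_times_ennreal borel_measurable_prod_ennreal measurable_compose[OF s]) auto
  have "(\<integral>\<^sup>+\<omega>. ?f (\<lambda>k. E k \<omega>) \<partial>M) = (\<integral>\<^sup>+\<omega>. ?f (\<lambda>k\<in>{..<n}. E k \<omega>) \<partial>M)"
    by (intro nn_integral_cong arg_cong2[where f="(*)"] prod.cong arg_cong[where f=ennreal]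
          arg_cong[where f="cdf D"] arg_cong[where f=D.void_weight] sum.cong) auto
  also have "\<dots> = integral\<^sup>N (distr M (PiM {..<n} (\<lambda>_. borel)) (\<lambda>\<omega>. \<lambda>k\<in>{..<n}. E k \<omega>)) ?f"
    by (subst nn_integral_distr) (auto simp: meas simp del: restrict_apply intro!: measurable_restrict)
  also have "\<dots> = integral\<^sup>N (PiM {..<n} (\<lambda>_. ?X)) ?f"
    using indep_vars_iff_distr_eq_PiM[where I="{..<n}" and M'="\<lambda>_. borel" and X=E] False indep_vars_subset[OF E, of "{..<n}"]
    by (simp add: X lessThan_empty_iff)
  also have "\<dots> = ennreal (D.void_weight 0)"
    by (rule D.nn_integral_void_weight_arrivals[OF int])
  finally show ?thesis .
qed (simp add: emeasure_space_1)

lemma (in prob_space) prob_arrivals_dominate: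
  fixes E V :: "nat \<Rightarrow> 'a \<Rightarrow> real"
  assumes E: "indep_vars (\<lambda>_. borel) E UNIV"
    and dE: "\<And>k. distributed M lborel (E k) (exponential_density 1)"
    and V: "indep_vars (\<lambda>_. borel) V UNIV"
    and dV: "\<And>i. distr M borel (V i) = D"
    and int: "integrable D (\<lambda>v. v)"
    and EV: "indep_var (PiM UNIV (\<lambda>_. borel)) (\<lambda>\<omega> k. E k \<omega>) (PiM UNIV (\<lambda>_. borel)) (\<lambda>\<omega> i. V i \<omega>)"
  shows "prob {\<omega> \<in> space M. \<forall>i. V i \<omega> \<le> (\<Sum>k\<le>i. E k \<omega>)} = exp (- (LINT v|D. max v 0))"
proof -
  have [measurable]: "random_variable borel (E i)" "random_variable borel (V i)" for i
    using E V by (auto simp: indep_vars_def)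
  interpret D: real_distribution D unfolding dV[of 0, symmetric] by simp
  note [measurable] = D.void_weight_measurable[OF int]
  define G where "G n \<omega> = (\<Sum>k<n. E k \<omega>)" for n \<omega>
  define P where "P n \<omega> = (\<Prod>i<n. cdf D (G (Suc i) \<omega>))" for n \<omega>
  define A where "A n = {\<omega> \<in> space M. \<forall>i<n. V i \<omega> \<le> G (Suc i) \<omega>}" for n
  have [measurable]: "G n \<in> borel_measurable M" "P n \<in> borel_measurable M" "A n \<in> sets M" for n
    unfolding G_def P_def A_def by measurable
  have P01: "0 \<le> P n \<omega>" "P n \<omega> \<le> 1" for n \<omega>
    unfolding P_def by (auto intro!: prod_nonneg prod_le_1 simp: D.cdf_nonneg D.cdf_bounded_prob)
  have w01: "0 \<le> D.void_weight s" "D.void_weight s \<le> 1" for s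
    using D.void_weight_pos[of s] D.void_weight_le_1[OF int] by simp_all
  have P_prod: "(\<Prod>i<n. ennreal (cdf D (\<Sum>k\<le>i. E k \<omega>))) = ennreal (P n \<omega>)" for n \<omega>
    by (simp add: P_def G_def prod_ennreal D.cdf_nonneg lessThan_Suc_atMost)
  have prob_A: "prob (A n) = (LINT \<omega>|M. P n \<omega>)" for n
    using prob_arrivals_dominate_finite[OF V dV EV, of n] P01
    unfolding P_prod A_def G_def lessThan_Suc_atMost
    by (subst integral_eq_nn_integral) (auto simp: measure_def)
  have weighted: "(LINT \<omega>|M. P n \<omega> * D.void_weight (G n \<omega>)) = D.void_weight 0" for n
    using nn_integral_void_weight_indep[OF E dE D.real_distribution_axioms int, of n] P01 w01
    unfolding P_prod by (subst integral_eq_nn_integral) (auto simp: G_def ennreal_mult)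
  have expG: "integrable M (\<lambda>\<omega>. exp (- G n \<omega>))" "(LINT \<omega>|M. exp (- G n \<omega>)) = (1 / 2) ^ n" for n
    using nn_integral_exp_neg_arrival[OF E dE, of n, folded G_def]
    by (auto intro!: integrableI_nn_integral_finite simp: integral_eq_nn_integral)
  have intw: "integrable M (\<lambda>\<omega>. P n \<omega>)" "integrable M (\<lambda>\<omega>. P n \<omega> * D.void_weight (G n \<omega>))" for n
    by (rule integrable_const_bound[where B=1]; use P01 w01 in \<open>auto intro!: mult_le_one simp: abs_mult\<close>)+
  have diff: "prob (A n) - D.void_weight 0 = (LINT \<omega>|M. P n \<omega> * (1 - D.void_weight (G n \<omega>)))" for n
    unfolding prob_A weighted[of n, symmetric]
    by (subst Bochner_Integration.integral_diff[symmetric]) (auto simp: intw right_diff_distrib)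
  have lower: "D.void_weight 0 \<le> prob (A n)" for n
  proof -
    have "0 \<le> (LINT \<omega>|M. P n \<omega> * (1 - D.void_weight (G n \<omega>)))"
      using P01 w01 by (intro Bochner_Integration.integral_nonneg mult_nonneg_nonneg) auto
    then show ?thesis using diff[of n] by simp
  qed
  have upper: "prob (A n) \<le> D.void_weight 0 + (1 - D.void_weight (real m)) + exp (real m) * (1 / 2) ^ n" for n m
  proof -
    have le: "P n \<omega> * (1 - D.void_weight (G n \<omega>)) \<le> 1 - D.void_weight (real m) + exp (real m) * exp (- G n \<omega>)" for \<omega>
    proof -
      have "P n \<omega> * (1 - D.void_weight (G n \<omega>)) \<le> 1 * (1 - D.void_weight (G n \<omega>))"
        using P01 w01 by (intro mult_right_mono) auto
      also have "\<dots> \<le> 1 - D.void_weight (real m) + exp (real m) * exp (- G n \<omega>)"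
      proof (cases "real m \<le> G n \<omega>")
        case True
        then show ?thesis using monoD[OF D.mono_void_weight[OF int] True] by (simp add: add_increasing2)
      next
        case False
        then have "1 \<le> exp (real m) * exp (- G n \<omega>)" by (simp add: exp_add[symmetric])
        then have "1 - D.void_weight (real m) + 1 \<le> 1 - D.void_weight (real m) + exp (real m) * exp (- G n \<omega>)"
          by (rule add_left_mono)
        with w01(1)[of "G n \<omega>"] w01(2)[of "real m"] show ?thesis by simp
      qed
      finally show ?thesis .
    qed
    have "(LINT \<omega>|M. P n \<omega> * (1 - D.void_weight (G n \<omega>)))
      \<le> (LINT \<omega>|M. 1 - D.void_weight (real m) + exp (real m) * exp (- G n \<omega>))"
      using intw[of n] expG(1)[of n] by (intro integral_mono le) (auto simp: right_diff_distrib)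
    also have "\<dots> = 1 - D.void_weight (real m) + exp (real m) * (1 / 2) ^ n"
      using expG[of n] by (simp add: prob_space)
    finally show ?thesis using diff[of n] by linarith
  qed
  have "(\<lambda>n. prob (A n)) \<longlonglongrightarrow> D.void_weight 0"
  proof (rule LIMSEQ_I)
    fix r :: real assume "0 < r"
    then obtain m where m: "1 - D.void_weight (real m) < r / 2"
      using LIMSEQ_D[OF D.void_weight_tendsto_1[OF int], of "r / 2"] w01 by fastforce
    have "(\<lambda>n. exp (real m) * (1 / 2) ^ n) \<longlonglongrightarrow> exp (real m) * 0"
      by (intro tendsto_intros LIMSEQ_power_zero) simp
    from LIMSEQ_D[OF this, of "r / 2"] \<open>0 < r\<close> obtain N
      where N: "\<And>n. n \<ge> N \<Longrightarrow> exp (real m) * (1 / 2) ^ n < r / 2" by auto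
    show "\<exists>no. \<forall>n\<ge>no. norm (prob (A n) - D.void_weight 0) < r"
    proof (intro exI[of _ N] allI impI)
      fix n assume "N \<le> n"
      then show "norm (prob (A n) - D.void_weight 0) < r"
        using N[of n] m lower[of n] upper[of n m] by (simp add: abs_less_iff)
    qed
  qed
  moreover have "(\<lambda>n. prob (A n)) \<longlonglongrightarrow> prob (\<Inter>n. A n)"
    by (rule finite_Lim_measure_decseq) (auto simp: decseq_def A_def)
  ultimately have "prob (\<Inter>n. A n) = D.void_weight 0" by (rule LIMSEQ_unique[rotated])
  also have "(\<Inter>n. A n) = {\<omega> \<in> space M. \<forall>i. V i \<omega> \<le> (\<Sum>k\<le>i. E k \<omega>)}"
    unfolding A_def G_def lessThan_Suc_atMost by auto
  finally show ?thesis by (simp add: D.void_weight_def mean_max_def)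
qed

section \<open>The exponent of the max-stable process\<close>

definition total_order_on :: "'i set \<Rightarrow> ('i \<Rightarrow> 'i \<Rightarrow> bool) \<Rightarrow> bool" where
  "total_order_on I le \<longleftrightarrow> (\<forall>a\<in>I. \<forall>b\<in>I. le a b \<or> le b a) \<and>
     (\<forall>a\<in>I. \<forall>b\<in>I. le a b \<longrightarrow> le b a \<longrightarrow> a = b) \<and>
     (\<forall>a\<in>I. \<forall>b\<in>I. \<forall>c\<in>I. le a b \<longrightarrow> le b c \<longrightarrow> le a c)"

lemma total_order_on_linorder: "total_order_on I ((\<le>) :: 'i::linorder \<Rightarrow> 'i \<Rightarrow> bool)"
  by (auto simp: total_order_on_def)

lemma total_order_on_lex_le: "total_order_on I lex_le"
  unfolding total_order_on_def lex_le_def by (auto simp: prod_eq_iff)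

lemma ex_least_total_order_on:
  assumes "finite A" "A \<noteq> {}" "total_order_on I le" "A \<subseteq> I"
  shows "\<exists>m\<in>A. \<forall>a\<in>A. le m a"
  using assms(1,2,4)
proof (induction rule: finite_ne_induct)
  case (singleton x)
  then show ?case using assms(3) by (auto simp: total_order_on_def)
next
  case (insert x F)
  then obtain m where m: "m \<in> F" "\<forall>a\<in>F. le m a" by auto
  have I: "x \<in> I" "m \<in> I" "F \<subseteq> I" using insert m by auto
  have tot: "\<And>a b. a \<in> I \<Longrightarrow> b \<in> I \<Longrightarrow> le a b \<or> le b a"
    and tr: "\<And>a b c. a \<in> I \<Longrightarrow> b \<in> I \<Longrightarrow> c \<in> I \<Longrightarrow> le a b \<Longrightarrow> le b c \<Longrightarrow> le a c"
    using assms(3) unfolding total_order_on_def by blast+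
  show ?case
  proof (cases "le m x")
    case True
    then show ?thesis using m by auto
  next
    case False
    then have "le x m" using tot[OF I(1,2)] by auto
    then have "le x a" if "a \<in> F" for a using tr[OF I(1,2)] m I(3) that by blast
    moreover have "le x x" using tot[OF I(1) I(1)] by auto
    ultimately show ?thesis by auto
  qed
qed

context
  fixes I :: "'i set" and le :: "'i \<Rightarrow> 'i \<Rightarrow> bool"
  assumes I: "finite I" "I \<noteq> {}" and le: "total_order_on I le"
begin

lemma
  fixes f :: "'i \<Rightarrow> real"
  shows infargmax_mem: "infargmax le I f \<in> I"
    and infargmax_ge: "i \<in> I \<Longrightarrow> f i \<le> f (infargmax le I f)"
    and infargmax_eq_iff: "l \<in> I \<Longrightarrow>
      infargmax le I f = l \<longleftrightarrow> (\<forall>i\<in>I. f i \<le> f l \<and> (f i = f l \<longrightarrow> le l i))"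
proof -
  define P where "P j \<longleftrightarrow> j \<in> I \<and> (\<forall>i\<in>I. f i \<le> f j) \<and> (\<forall>i\<in>I. f i = f j \<longrightarrow> le j i)" for j
  define A where "A = {j \<in> I. \<forall>i\<in>I. f i \<le> f j}"
  have "Max (f ` I) \<in> f ` I" using I by (intro Max_in) auto
  then obtain j where "j \<in> I" "f j = Max (f ` I)" by auto
  then have "j \<in> A" using I by (auto simp: A_def)
  then obtain m where m: "m \<in> A" "\<forall>a\<in>A. le m a"
    using ex_least_total_order_on[OF _ _ le, of A] I by (auto simp: A_def)
  then have Pm: "P m" by (auto simp: P_def A_def)
  have uniq: "j = j'" if "P j" "P j'" for j j'
  proof -
    have "f j = f j'" using that by (auto simp: P_def intro: antisym)
    then show ?thesis using that le by (auto simp: P_def total_order_on_def)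
  qed
  have arg: "infargmax le I f = (THE j. P j)" unfolding infargmax_def P_def by simp
  also have "\<dots> = m" by (rule the_equality[where P=P, OF Pm uniq[OF _ Pm]])
  finally have m_eq: "infargmax le I f = m" .
  then show "infargmax le I f \<in> I" "i \<in> I \<Longrightarrow> f i \<le> f (infargmax le I f)"
    using Pm by (auto simp: P_def)
  have "infargmax le I f = l \<longleftrightarrow> P l" using Pm uniq m_eq by auto
  then show "infargmax le I f = l \<longleftrightarrow> (\<forall>i\<in>I. f i \<le> f l \<and> (f i = f l \<longrightarrow> le l i))" if "l \<in> I"
    using that by (auto simp: P_def)
qed

lemma infargmax_cmult:
  fixes f :: "'i \<Rightarrow> real"
  assumes "0 < c" "l \<in> I"
  shows "infargmax le I (\<lambda>i. c * f i) = l \<longleftrightarrow> infargmax le I f = l"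
  using assms by (simp add: infargmax_eq_iff)

lemma pred_infargmax:
  fixes F :: "'i \<Rightarrow> 'a \<Rightarrow> real"
  assumes "l \<in> I" and [measurable]: "\<And>i. F i \<in> borel_measurable M"
  shows "Measurable.pred M (\<lambda>x. infargmax le I (\<lambda>i. F i x) = l)"
  unfolding infargmax_eq_iff[OF assms(1)] using I by measurable

lemma Max_eq_sum_infargmax:
  fixes f u :: "'i \<Rightarrow> real"
  assumes mono: "\<And>i j. i \<in> I \<Longrightarrow> j \<in> I \<Longrightarrow> f i \<le> f j \<Longrightarrow> u i \<le> u j"
  shows "Max (u ` I) = (\<Sum>l\<in>I. u l * of_bool (infargmax le I f = l))"
proof -
  let ?m = "infargmax le I f"
  have m: "?m \<in> I" "\<And>i. i \<in> I \<Longrightarrow> f i \<le> f ?m" by (fact infargmax_mem infargmax_ge)+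
  have "(\<Sum>l\<in>I. u l * of_bool (?m = l)) = u ?m"
    using m I by (simp add: of_bool_def if_distrib sum.delta cong: if_cong)
  moreover have "Max (u ` I) = u ?m"
    using I m mono by (intro Max_eqI) auto
  ultimately show ?thesis by simp
qed

end

lemma infnorm_vdiv:
  fixes y z :: "real ^ 'd"
  assumes "\<And>i. 0 \<le> y $ i" "\<And>i. 0 < z $ i"
  shows "infnorm (vdiv y z) = Max (range (\<lambda>i. y $ i / z $ i))"
proof -
  have B: "(Basis :: (real ^ 'd) set) = range (\<lambda>i. axis i 1)" by (auto simp: Basis_vec_def)
  have ax: "\<bar>vdiv y z \<bullet> axis i 1\<bar> = y $ i / z $ i" for i
    using assms[of i] by (simp add: inner_axis vdiv_def less_imp_le)
  have "(\<lambda>b. \<bar>vdiv y z \<bullet> b\<bar>) ` Basis = range (\<lambda>i. y $ i / z $ i)"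
    by (simp only: B image_image ax)
  then show ?thesis by (simp add: infnorm_Max)
qed

text \<open>The functional of degree \<open>\<alpha>\<close> whose mean under the law of \<open>Z\<close> is \<open>- ln \<P>(\<forall>j. X (t j) \<le> x j)\<close>.\<close>

definition exponent_fun ::
    "real \<Rightarrow> nat \<Rightarrow> (nat \<Rightarrow> real ^ 'p) \<Rightarrow> (nat \<Rightarrow> real ^ 'd) \<Rightarrow> (real ^ 'p \<Rightarrow> real ^ 'd) \<Rightarrow> real" where
  "exponent_fun \<alpha> n t x f = Max ((\<lambda>(i, j). (f (t j) $ i / x j $ i) powr \<alpha>) ` (UNIV \<times> {1..n}))"

lemma exponent_fun_eq_infnorm:
  assumes "0 < \<alpha>" "1 \<le> n" and x: "\<And>j i. j \<in> {1..n} \<Longrightarrow> 0 < x j $ i" and f: "\<And>t i. 0 \<le> f t $ i"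
  shows "exponent_fun \<alpha> n t x f = Max ((\<lambda>j. infnorm (vdiv (f (t j)) (x j)) powr \<alpha>) ` {1..n})"
  unfolding exponent_fun_def
proof (rule Max_eqI)
  let ?G = "\<lambda>j. Max (range (\<lambda>i. f (t j) $ i / x j $ i))"
  have G: "infnorm (vdiv (f (t j)) (x j)) = ?G j" if "j \<in> {1..n}" for j
    using x[OF that] f by (intro infnorm_vdiv)
  have "Max ((\<lambda>j. infnorm (vdiv (f (t j)) (x j)) powr \<alpha>) ` {1..n})
    \<in> (\<lambda>j. infnorm (vdiv (f (t j)) (x j)) powr \<alpha>) ` {1..n}"
    using \<open>1 \<le> n\<close> by (intro Max_in) auto
  then obtain j where j: "j \<in> {1..n}"
    "Max ((\<lambda>j. infnorm (vdiv (f (t j)) (x j)) powr \<alpha>) ` {1..n}) = ?G j powr \<alpha>"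
    using G by auto
  have "?G j \<in> range (\<lambda>i. f (t j) $ i / x j $ i)" by (intro Max_in) auto
  then obtain i where "?G j = f (t j) $ i / x j $ i" by blast
  then show "Max ((\<lambda>j. infnorm (vdiv (f (t j)) (x j)) powr \<alpha>) ` {1..n})
      \<in> (\<lambda>(i, j). (f (t j) $ i / x j $ i) powr \<alpha>) ` (UNIV \<times> {1..n})"
    using j by (auto intro!: image_eqI[where x="(i, j)"])
  fix y assume "y \<in> (\<lambda>(i, j). (f (t j) $ i / x j $ i) powr \<alpha>) ` (UNIV \<times> {1..n})"
  then obtain i j where ij: "j \<in> {1..n}" "y = (f (t j) $ i / x j $ i) powr \<alpha>" by auto
  have "y \<le> infnorm (vdiv (f (t j)) (x j)) powr \<alpha>"
    unfolding ij(2) G[OF ij(1)] using x[OF ij(1), of i] f[of "t j" i] \<open>0 < \<alpha>\<close>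
    by (intro powr_mono2) auto
  then show "y \<le> Max ((\<lambda>j. infnorm (vdiv (f (t j)) (x j)) powr \<alpha>) ` {1..n})"
    using ij by (intro order_trans[OF _ Max_ge]) auto
qed auto

lemma exponent_fun_nonneg: "1 \<le> n \<Longrightarrow> 0 \<le> exponent_fun \<alpha> n t x f"
  unfolding exponent_fun_def by (subst Max_ge_iff) auto

lemma vec_nth_borel_measurable: "(\<lambda>v :: real ^ 'd. v $ i) \<in> borel_measurable borel"
  by (intro borel_measurable_continuous_onI continuous_intros)

lemma exponent_fun_measurable[measurable]: "exponent_fun \<alpha> n t x \<in> borel_measurable path_space"
proof -
  have [measurable]: "(\<lambda>f :: real ^ 'a \<Rightarrow> real ^ 'b. f s $ i) \<in> borel_measurable path_space" for s i
    by (rule measurable_compose[OF measurable_path_space_eval vec_nth_borel_measurable])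
  show ?thesis
    unfolding exponent_fun_def[abs_def] case_prod_beta by (intro borel_measurable_Max) auto
qed

lemma exponent_fun_scale:
  assumes "1 \<le> n" "0 \<le> c" and x: "\<And>j i. j \<in> {1..n} \<Longrightarrow> 0 < x j $ i" and f: "\<And>t i. 0 \<le> f t $ i"
  shows "exponent_fun \<alpha> n t x (\<lambda>t. c *\<^sub>R f t) = c powr \<alpha> * exponent_fun \<alpha> n t x f"
proof -
  have "(\<lambda>(i, j). ((c *\<^sub>R f (t j)) $ i / x j $ i) powr \<alpha>) ` (UNIV \<times> {1..n})
      = (*) (c powr \<alpha>) ` (\<lambda>(i, j). (f (t j) $ i / x j $ i) powr \<alpha>) ` (UNIV \<times> {1..n})"
    unfolding image_image
  proof (intro image_cong refl)
    fix ij :: "'a \<times> nat" assume "ij \<in> UNIV \<times> {1..n}"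
    then show "(case ij of (i, j) \<Rightarrow> ((c *\<^sub>R f (t j)) $ i / x j $ i) powr \<alpha>)
        = c powr \<alpha> * (case ij of (i, j) \<Rightarrow> (f (t j) $ i / x j $ i) powr \<alpha>)"
      using f x \<open>0 \<le> c\<close> by (auto simp: powr_mult[symmetric] less_imp_le)
  qed
  moreover have "mono ((*) (c powr \<alpha>))" by (intro monoI mult_left_mono) auto
  ultimately show ?thesis
    unfolding exponent_fun_def using \<open>1 \<le> n\<close> by (simp add: mono_Max_commute)
qed

lemma powr_quotient_le_iff:
  fixes a b z :: real
  assumes "0 < \<alpha>" "0 < g" "0 \<le> z" "0 < x"
  shows "g powr (- 1 / \<alpha>) * z \<le> x \<longleftrightarrow> (z / x) powr \<alpha> \<le> g"
proof -
  have "g powr (- 1 / \<alpha>) * z \<le> x \<longleftrightarrow> z / x \<le> g powr (1 / \<alpha>)"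
    using assms by (simp add: powr_minus field_simps)
  also have "\<dots> \<longleftrightarrow> (z / x) powr \<alpha> \<le> (g powr (1 / \<alpha>)) powr \<alpha>"
    using assms powr_less_mono2[of \<alpha> "g powr (1 / \<alpha>)" "z / x"] powr_mono2[of \<alpha> "z / x" "g powr (1 / \<alpha>)"]
    by (metis divide_nonneg_pos less_imp_le not_less powr_ge_zero)
  also have "(g powr (1 / \<alpha>)) powr \<alpha> = g" using assms by (simp add: powr_powr)
  finally show ?thesis .
qed

lemma spectral_process_void_prob:
  fixes X :: "'x \<Rightarrow> real ^ 'p \<Rightarrow> real ^ 'd" and Z :: "'m \<Rightarrow> real ^ 'p \<Rightarrow> real ^ 'd"
  assumes sp: "spectral_process TYPE('r) \<alpha> M Z P X" and \<alpha>: "0 < \<alpha>" and n: "1 \<le> n"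
    and x: "\<And>j i. j \<in> {1..n} \<Longrightarrow> 0 < x j $ i"
    and int: "integrable M (\<lambda>\<omega>. exponent_fun \<alpha> n t x (Z \<omega>))"
  shows "measure P {\<omega> \<in> space P. \<forall>j\<in>{1..n}. X \<omega> (t j) \<le> x j}
    = exp (- (LINT \<omega>|M. exponent_fun \<alpha> n t x (Z \<omega>)))"
proof -
  let ?e = "exponent_fun \<alpha> n t x"
  let ?\<Pi> = "PiM UNIV (\<lambda>_. borel) :: ((real ^ 'p) \<times> 'd \<Rightarrow> ennreal) measure"
  let ?N = "PiM UNIV (\<lambda>_. borel) :: (nat \<Rightarrow> real) measure"
  obtain R :: "'r measure" and E :: "nat \<Rightarrow> 'r \<Rightarrow> real" and Zs where R: "prob_space R"
    and E: "prob_space.indep_vars R (\<lambda>_. borel) E UNIV"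
    and dE: "\<And>k. distributed R lborel (E k) (\<lambda>u. ennreal (exponential_density 1 u))"
    and Zs: "prob_space.indep_vars R (\<lambda>_. path_space) Zs UNIV"
    and dZs: "\<And>i. distr R path_space (Zs i) = distr M path_space Z"
    and EZ: "prob_space.indep_set R
          (sets (vimage_algebra (space R) (\<lambda>\<omega> k. E k \<omega>) ?N))
          (sets (vimage_algebra (space R) (\<lambda>\<omega> i. Zs i \<omega>) (PiM UNIV (\<lambda>_. path_space))))"
    and law: "distr P ?\<Pi> (\<lambda>\<omega> (t, i). ennreal (X \<omega> t $ i)) =
        distr R ?\<Pi>
          (\<lambda>\<omega> (t, j). SUP i. ennreal ((\<Sum>k\<le>i. E k \<omega>) powr (- 1 / \<alpha>) * Zs i \<omega> t $ j))"
    using sp unfolding spectral_process_def by blast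
  have P: "prob_space P" and [measurable]: "\<And>t. (\<lambda>\<omega>. X \<omega> t) \<in> borel_measurable P"
    and Z[measurable]: "Z \<in> measurable M path_space"
    and X0: "\<And>\<omega> t i. \<omega> \<in> space P \<Longrightarrow> 0 \<le> X \<omega> t $ i"
    using sp unfolding spectral_process_def by auto
  interpret R: prob_space R by fact
  have [measurable]: "E k \<in> borel_measurable R" "Zs i \<in> measurable R path_space" for k i
    using E Zs by (auto simp: R.indep_vars_def)
  have Zs_eval[measurable]: "(\<lambda>\<omega>. Zs i \<omega> s) \<in> borel_measurable R" for i s
    by (rule measurable_compose[of "Zs i", OF _ measurable_path_space_eval]) simp
  have Zs0: "0 \<le> Zs i \<omega> s $ j" if "\<omega> \<in> space R" for i \<omega> s j
    using measurable_space[of "Zs i" R path_space \<omega>] that by (auto simp: space_path_space cpaths_def)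
  define G where "G i \<omega> = (\<Sum>k\<le>i. E k \<omega>)" for i \<omega>
  have [measurable]: "G i \<in> borel_measurable R" for i unfolding G_def by measurable
  define V where "V = (\<lambda>i \<omega>. ?e (Zs i \<omega>))"
  have [measurable]: "V i \<in> borel_measurable R" for i unfolding V_def by measurable
  have V: "R.indep_vars (\<lambda>_. borel) V UNIV"
    unfolding V_def by (rule R.indep_vars_compose2[OF Zs]) simp
  have dV: "distr R borel (V i) = distr M borel (\<lambda>\<omega>. ?e (Z \<omega>))" for i
  proof -
    have "distr R borel (V i) = distr (distr R path_space (Zs i)) borel ?e"
      by (subst distr_distr) (auto simp: V_def comp_def)
    also have "\<dots> = distr M borel (\<lambda>\<omega>. ?e (Z \<omega>))"
      unfolding dZs by (subst distr_distr) (auto simp: comp_def)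
    finally show ?thesis .
  qed
  have EV: "R.indep_var ?N (\<lambda>\<omega> k. E k \<omega>) ?N (\<lambda>\<omega> i. V i \<omega>)"
    unfolding R.indep_var_eq
  proof (intro conjI)
    show "(\<lambda>\<omega> k. E k \<omega>) \<in> measurable R ?N" "(\<lambda>\<omega> i. V i \<omega>) \<in> measurable R ?N"
      by (rule measurable_PiM_single'; simp)+
    let ?A = "sigma_sets (space R) {(\<lambda>\<omega> k. E k \<omega>) -` A \<inter> space R | A. A \<in> sets ?N}"
    let ?B = "sigma_sets (space R) {(\<lambda>\<omega> i. V i \<omega>) -` A \<inter> space R | A. A \<in> sets ?N}"
    have A: "?A = sets (vimage_algebra (space R) (\<lambda>\<omega> k. E k \<omega>) ?N)"
      by (simp add: vimage_algebra_def sets_measure_of_conv) auto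
    have "(\<lambda>\<omega> i. V i \<omega>) -` A \<inter> space R \<in> sets (vimage_algebra (space R) (\<lambda>\<omega> i. Zs i \<omega>) (PiM UNIV (\<lambda>_. path_space)))"
      if "A \<in> sets ?N" for A
    proof -
      have "(\<lambda>z i. ?e (z i)) \<in> measurable (PiM UNIV (\<lambda>_::nat. path_space)) ?N"
      proof (rule measurable_PiM_single')
        fix i :: nat
        have "(\<lambda>z. z i) \<in> measurable (PiM UNIV (\<lambda>_::nat. path_space)) path_space"
          by (rule measurable_component_singleton) simp
        then show "(\<lambda>z. ?e (z i)) \<in> borel_measurable (PiM UNIV (\<lambda>_::nat. path_space))"
          by (rule measurable_compose) simp
      qed simp
      from measurable_sets[OF this that]
      have "(\<lambda>\<omega> i. Zs i \<omega>) -` ((\<lambda>z i. ?e (z i)) -` A \<inter> space (PiM UNIV (\<lambda>_. path_space))) \<inter> space R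
        \<in> sets (vimage_algebra (space R) (\<lambda>\<omega> i. Zs i \<omega>) (PiM UNIV (\<lambda>_. path_space)))"
        by (rule in_vimage_algebra)
      also have "(\<lambda>\<omega> i. Zs i \<omega>) -` ((\<lambda>z i. ?e (z i)) -` A \<inter> space (PiM UNIV (\<lambda>_. path_space))) \<inter> space R
        = (\<lambda>\<omega> i. V i \<omega>) -` A \<inter> space R"
        using measurable_space[of "Zs _" R path_space] by (auto simp: V_def space_PiM)
      finally show ?thesis .
    qed
    then have "{(\<lambda>\<omega> i. V i \<omega>) -` A \<inter> space R | A. A \<in> sets ?N}
      \<subseteq> sets (vimage_algebra (space R) (\<lambda>\<omega> i. Zs i \<omega>) (PiM UNIV (\<lambda>_. path_space)))" by blast
    from sets.sigma_sets_subset[OF this]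
    have B: "?B \<subseteq> sets (vimage_algebra (space R) (\<lambda>\<omega> i. Zs i \<omega>) (PiM UNIV (\<lambda>_. path_space)))"
      by (simp only: space_vimage_algebra)
    show "R.indep_set ?A ?B"
      using EZ unfolding R.indep_set_def A
      by (rule R.indep_sets_mono_sets) (use B in \<open>auto split: bool.splits\<close>)
  qed
  have E_pos: "AE \<omega> in R. \<forall>k. 0 < E k \<omega>"
  proof (subst AE_all_countable, intro allI)
    fix k
    have "AE u in lborel. 0 < ennreal (exponential_density 1 u) \<longrightarrow> 0 < u"
      using AE_lborel_singleton[of 0] by eventually_elim (auto simp: exponential_density_def)
    then show "AE \<omega> in R. 0 < E k \<omega>"
      by (subst R.distributed_AE2[OF dE]) auto
  qed
  define B where "B = {f \<in> space ?\<Pi>. \<forall>j\<in>{1..n}. \<forall>i. f (t j, i) \<le> ennreal (x j $ i)}"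
  have B: "B \<in> sets ?\<Pi>"
  proof -
    have [measurable]: "(\<lambda>f. f c) \<in> borel_measurable ?\<Pi>" for c
      by (rule measurable_component_singleton) simp
    show ?thesis unfolding B_def by measurable
  qed
  have [measurable]: "(\<lambda>\<omega>. X \<omega> s $ i) \<in> borel_measurable P" for s i
    by (rule measurable_compose[OF _ vec_nth_borel_measurable]) simp
  have [measurable]: "(\<lambda>\<omega>. Zs k \<omega> s $ i) \<in> borel_measurable R" for k s i
    by (rule measurable_compose[OF Zs_eval vec_nth_borel_measurable])
  have mX: "(\<lambda>\<omega> (t, i). ennreal (X \<omega> t $ i)) \<in> measurable P ?\<Pi>"
    by (rule measurable_PiM_single') auto
  have mR: "(\<lambda>\<omega> (t, j). SUP i. ennreal ((\<Sum>k\<le>i. E k \<omega>) powr (- 1 / \<alpha>) * Zs i \<omega> t $ j)) \<in> measurable R ?\<Pi>"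
    by (rule measurable_PiM_single') auto
  have "measure P {\<omega> \<in> space P. \<forall>j\<in>{1..n}. X \<omega> (t j) \<le> x j}
      = measure (distr P ?\<Pi> (\<lambda>\<omega> (t, i). ennreal (X \<omega> t $ i))) B"
    unfolding measure_distr[OF mX B]
    using x by (intro arg_cong[where f="measure P"])
      (auto simp: B_def space_PiM less_eq_vec_def ennreal_le_iff less_imp_le)
  also have "\<dots> = measure R ((\<lambda>\<omega> (t, j). SUP i. ennreal ((\<Sum>k\<le>i. E k \<omega>) powr (- 1 / \<alpha>) * Zs i \<omega> t $ j)) -` B \<inter> space R)"
    unfolding law measure_distr[OF mR B] ..
  also have "\<dots> = measure R {\<omega> \<in> space R. \<forall>i. V i \<omega> \<le> G i \<omega>}"
  proof (rule measure_eq_AE)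
    show "(\<lambda>\<omega> (t, j). SUP i. ennreal ((\<Sum>k\<le>i. E k \<omega>) powr (- 1 / \<alpha>) * Zs i \<omega> t $ j)) -` B \<inter> space R \<in> sets R"
      by (rule measurable_sets[OF mR B])
    show "{\<omega> \<in> space R. \<forall>i. V i \<omega> \<le> G i \<omega>} \<in> sets R" by measurable
    show "AE \<omega> in R. \<omega> \<in> (\<lambda>\<omega> (t, j). SUP i. ennreal ((\<Sum>k\<le>i. E k \<omega>) powr (- 1 / \<alpha>) * Zs i \<omega> t $ j)) -` B \<inter> space R
      \<longleftrightarrow> \<omega> \<in> {\<omega> \<in> space R. \<forall>i. V i \<omega> \<le> G i \<omega>}"
      using E_pos AE_space
    proof eventually_elim
      fix \<omega> assume pos: "\<forall>k. 0 < E k \<omega>" and \<omega>: "\<omega> \<in> space R"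
      have Gp: "0 < G i \<omega>" for i unfolding G_def using pos by (intro sum_pos) auto
      have "V i \<omega> \<le> G i \<omega> \<longleftrightarrow> (\<forall>l\<in>{1..n}. \<forall>j. (Zs i \<omega> (t l) $ j / x l $ j) powr \<alpha> \<le> G i \<omega>)" for i
        unfolding V_def exponent_fun_def using n by (subst Max_le_iff) auto
      also have "(\<forall>l\<in>{1..n}. \<forall>j. (Zs i \<omega> (t l) $ j / x l $ j) powr \<alpha> \<le> G i \<omega>)
        \<longleftrightarrow> (\<forall>l\<in>{1..n}. \<forall>j. ennreal (G i \<omega> powr (- 1 / \<alpha>) * Zs i \<omega> (t l) $ j) \<le> ennreal (x l $ j))" for i
      proof (intro ball_cong refl all_cong1)
        fix l j assume "l \<in> {1..n}"
        then have "0 < x l $ j" by (rule x)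
        then show "(Zs i \<omega> (t l) $ j / x l $ j) powr \<alpha> \<le> G i \<omega>
          \<longleftrightarrow> ennreal (G i \<omega> powr (- 1 / \<alpha>) * Zs i \<omega> (t l) $ j) \<le> ennreal (x l $ j)"
          using powr_quotient_le_iff[OF \<alpha> Gp Zs0[OF \<omega>]] by (simp only: ennreal_le_iff less_imp_le)
      qed
      finally have "(\<forall>i. V i \<omega> \<le> G i \<omega>) \<longleftrightarrow>
        (\<forall>l\<in>{1..n}. \<forall>j. (SUP i. ennreal (G i \<omega> powr (- 1 / \<alpha>) * Zs i \<omega> (t l) $ j)) \<le> ennreal (x l $ j))"
        by (auto simp: SUP_le_iff)
      then show "\<omega> \<in> (\<lambda>\<omega> (t, j). SUP i. ennreal ((\<Sum>k\<le>i. E k \<omega>) powr (- 1 / \<alpha>) * Zs i \<omega> t $ j)) -` B \<inter> space R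
        \<longleftrightarrow> \<omega> \<in> {\<omega> \<in> space R. \<forall>i. V i \<omega> \<le> G i \<omega>}"
        using \<omega> by (simp add: B_def space_PiM G_def)
    qed
  qed
  also have "\<dots> = exp (- (LINT v|distr M borel (\<lambda>\<omega>. ?e (Z \<omega>)). max v 0))"
    unfolding G_def
    by (rule R.prob_arrivals_dominate[OF E dE V dV _ EV]) (simp add: integrable_distr_eq int)
  also have "(LINT v|distr M borel (\<lambda>\<omega>. ?e (Z \<omega>)). max v 0) = (LINT \<omega>|M. ?e (Z \<omega>))"
    by (subst integral_distr) (auto simp: max_absorb1 exponent_fun_nonneg[OF n])
  finally show ?thesis .
qed

lemma nn_integral_has_alpha_density:
  assumes S: "has_alpha_density \<alpha> g Q S" and m: "alpha_mass \<alpha> g \<noteq> 0" "alpha_mass \<alpha> g < \<infinity>"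
    and [measurable]: "g \<in> borel_measurable borel" "H \<in> borel_measurable borel"
  shows "(\<integral>\<^sup>+s. ennreal (g s powr \<alpha>) * H s \<partial>lborel) = alpha_mass \<alpha> g * (\<integral>\<^sup>+\<omega>. H (S \<omega>) \<partial>Q)"
proof -
  have "(\<integral>\<^sup>+\<omega>. H (S \<omega>) \<partial>Q) = (\<integral>\<^sup>+s. ennreal (g s powr \<alpha>) / alpha_mass \<alpha> g * H s \<partial>lborel)"
    using S unfolding has_alpha_density_def
    by (intro distributed_nn_integral[symmetric, where N=lborel]) auto
  also have "\<dots> = (\<integral>\<^sup>+s. ennreal (g s powr \<alpha>) * H s / alpha_mass \<alpha> g \<partial>lborel)"
    by (simp add: ennreal_divide_times ennreal_times_divide)
  also have "\<dots> = (\<integral>\<^sup>+s. ennreal (g s powr \<alpha>) * H s \<partial>lborel) / alpha_mass \<alpha> g"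
    by (rule nn_integral_divide) measurable
  finally show ?thesis
    using ennreal_mult_divide_eq[OF m(1), of "\<integral>\<^sup>+s. ennreal (g s powr \<alpha>) * H s \<partial>lborel"] m(2)
    by (simp add: ennreal_times_divide mult.commute[of "alpha_mass \<alpha> g"])
qed

lemma nn_integral_Max_split:
  fixes L :: "real ^ 'p \<Rightarrow> real ^ 'd" and v :: "'i \<Rightarrow> real ^ 'd \<Rightarrow> real" and \<tau> :: "'i \<Rightarrow> real ^ 'p"
  assumes I: "finite I" "I \<noteq> {}" and le: "total_order_on I le" and "0 < \<alpha>"
    and L: "L \<in> borel_measurable borel" and v: "\<And>i. v i \<in> borel_measurable borel"
    and v0: "\<And>i s. i \<in> I \<Longrightarrow> 0 \<le> v i (L s)"
  shows "(\<integral>\<^sup>+w. ennreal (Max ((\<lambda>i. v i (L (\<tau> i - w)) powr \<alpha>) ` I)) \<partial>lborel)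
    = (\<Sum>l\<in>I. \<integral>\<^sup>+s. ennreal (v l (L s) powr \<alpha>
        * of_bool (infargmax le I (\<lambda>i. v i (L (\<tau> i - \<tau> l + s))) = l)) \<partial>lborel)"
proof -
  note [measurable] = L
  define F where "F l s = ennreal (v l (L s) powr \<alpha>
        * of_bool (infargmax le I (\<lambda>i. v i (L (\<tau> i - \<tau> l + s))) = l))" for l s
  have vL: "(\<lambda>s. v i (L (c + s))) \<in> borel_measurable borel" for i c
    by (rule measurable_compose[OF _ v]) measurable
  have F: "F l \<in> borel_measurable borel" if "l \<in> I" for l
  proof -
    have [measurable]: "Measurable.pred borel (\<lambda>s. infargmax le I (\<lambda>i. v i (L (\<tau> i - \<tau> l + s))) = l)"
      using vL by (intro pred_infargmax[OF I le that])
    have [measurable]: "(\<lambda>s. v l (L s)) \<in> borel_measurable borel" using vL[of l 0] by simp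
    show ?thesis unfolding F_def by measurable
  qed
  have "(\<integral>\<^sup>+w. ennreal (Max ((\<lambda>i. v i (L (\<tau> i - w)) powr \<alpha>) ` I)) \<partial>lborel)
      = (\<integral>\<^sup>+w. (\<Sum>l\<in>I. F l (\<tau> l - w)) \<partial>lborel)"
  proof (rule nn_integral_cong)
    fix w
    have "Max ((\<lambda>i. v i (L (\<tau> i - w)) powr \<alpha>) ` I)
      = (\<Sum>l\<in>I. v l (L (\<tau> l - w)) powr \<alpha> * of_bool (infargmax le I (\<lambda>i. v i (L (\<tau> i - w))) = l))"
      using v0 \<open>0 < \<alpha>\<close> by (intro Max_eq_sum_infargmax[OF I le] powr_mono2) auto
    then show "ennreal (Max ((\<lambda>i. v i (L (\<tau> i - w)) powr \<alpha>) ` I)) = (\<Sum>l\<in>I. F l (\<tau> l - w))"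
      by (simp add: F_def sum_ennreal)
  qed
  also have "\<dots> = (\<Sum>l\<in>I. \<integral>\<^sup>+w. F l (\<tau> l - w) \<partial>lborel)"
    by (intro nn_integral_sum measurable_compose[OF _ F]) auto
  also have "\<dots> = (\<Sum>l\<in>I. \<integral>\<^sup>+s. F l s \<partial>lborel)"
    by (intro sum.cong nn_integral_lborel_reflect F) auto
  finally show ?thesis unfolding F_def .
qed

lemma nn_integral_exponent_fun_smith:
  fixes L :: "real ^ 'p \<Rightarrow> real ^ 'd"
  assumes "0 < \<alpha>" "1 \<le> n" and x: "\<And>j i. j \<in> {1..n} \<Longrightarrow> 0 < x j $ i"
    and L: "continuous_on UNIV L" "\<And>t i. 0 \<le> L t $ i"
    and W: "distributed M lborel W (\<lambda>t. ennreal (p t))" and p: "\<And>t. 0 < p t"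
  shows "(\<integral>\<^sup>+\<omega>. ennreal (exponent_fun \<alpha> n t x (smith_spectral \<alpha> p L W \<omega>)) \<partial>M)
    = (\<integral>\<^sup>+w. ennreal (exponent_fun \<alpha> n t x (\<lambda>s. L (s - w))) \<partial>lborel)"
proof -
  have "exponent_fun \<alpha> n t x (smith_spectral \<alpha> p L W \<omega>)
      = 1 / p (W \<omega>) * exponent_fun \<alpha> n t x (\<lambda>s. L (s - W \<omega>))" for \<omega>
    unfolding smith_spectral_def
    using \<open>0 < \<alpha>\<close> p[of "W \<omega>"]
    by (subst exponent_fun_scale[OF \<open>1 \<le> n\<close> _ x]) (simp_all add: L(2) powr_powr)
  then have "(\<integral>\<^sup>+\<omega>. ennreal (exponent_fun \<alpha> n t x (smith_spectral \<alpha> p L W \<omega>)) \<partial>M)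
    = (\<integral>\<^sup>+\<omega>. ennreal (1 / p (W \<omega>)) * ennreal (exponent_fun \<alpha> n t x (\<lambda>s. L (s - W \<omega>))) \<partial>M)"
    using p \<open>1 \<le> n\<close> by (simp only: ennreal_mult[OF _ exponent_fun_nonneg] zero_le_divide_1_iff less_imp_le)
  also have "\<dots> = (\<integral>\<^sup>+w. ennreal (exponent_fun \<alpha> n t x (\<lambda>s. L (s - w))) \<partial>lborel)"
  proof (rule nn_integral_inverse_density[OF W p])
    have [measurable]: "L \<in> borel_measurable borel" using L(1) by (rule borel_measurable_continuous_onI)
    have "(\<lambda>w s. L (s - w)) \<in> measurable borel path_space"
      by (rule measurable_path_spaceI)
         (auto simp: cpaths_def L(2) intro!: continuous_on_compose2[OF L(1)] continuous_intros)
    from measurable_compose[OF this exponent_fun_measurable]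
    show "(\<lambda>w. ennreal (exponent_fun \<alpha> n t x (\<lambda>s. L (s - w)))) \<in> borel_measurable borel"
      by simp
  qed
  finally show ?thesis .
qed

lemma infnorm_vdiv_measurable: "(\<lambda>y. infnorm (vdiv y z)) \<in> borel_measurable borel"
  unfolding vdiv_def divide_inverse
  by (intro borel_measurable_continuous_onI continuous_intros continuous_on_compose2[OF is_norm_continuous[OF is_norm_infnorm]]) auto

lemma smith_exponent_norm_form:
  fixes L :: "real ^ 'p \<Rightarrow> real ^ 'd"
  assumes \<alpha>: "0 < \<alpha>" and n: "1 \<le> n" and x: "\<And>j i. j \<in> {1..n} \<Longrightarrow> 0 < x j $ i"
    and L: "continuous_on UNIV L" "\<And>t i. 0 \<le> L t $ i"
    and m: "alpha_mass \<alpha> (\<lambda>t. infnorm (L t)) \<noteq> 0" "alpha_mass \<alpha> (\<lambda>t. infnorm (L t)) < \<infinity>"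
    and S: "has_alpha_density \<alpha> (\<lambda>t. infnorm (L t)) Q S"
    and fin: "(\<integral>\<^sup>+w. ennreal (exponent_fun \<alpha> n t x (\<lambda>s. L (s - w))) \<partial>lborel) < \<infinity>"
  shows "enn2real (\<integral>\<^sup>+w. ennreal (exponent_fun \<alpha> n t x (\<lambda>s. L (s - w))) \<partial>lborel) =
    enn2real (alpha_mass \<alpha> (\<lambda>t. infnorm (L t))) *
      (\<Sum>l\<in>{1..n}. LINT \<omega>|Q.
         infnorm (vdiv (L (S \<omega>)) (x l)) powr \<alpha> / infnorm (L (S \<omega>)) powr \<alpha> *
         of_bool (infargmax (\<le>) {1..n} (\<lambda>j. infnorm (vdiv (L (t j - t l + S \<omega>)) (x j))) = l))"
proof -
  have I: "finite {1..n}" "{1..n} \<noteq> {}" using n by auto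
  note le = total_order_on_linorder[of "{1..n}"]
  have [measurable]: "L \<in> borel_measurable borel" using L(1) by (rule borel_measurable_continuous_onI)
  have [measurable]: "S \<in> measurable Q borel"
    using S by (auto simp: has_alpha_density_def distributed_def)
  have [measurable]: "(\<lambda>t. infnorm (L t)) \<in> borel_measurable borel"
    by (rule measurable_compose[OF _ borel_measurable_continuous_onI[OF is_norm_continuous[OF is_norm_infnorm]]]) simp
  define c where "c = alpha_mass \<alpha> (\<lambda>t. infnorm (L t))"
  define b where "b l s = (of_bool (infargmax (\<le>) {1..n} (\<lambda>j. infnorm (vdiv (L (t j - t l + s)) (x j))) = l) :: real)" for l s
  define H where "H l s = infnorm (vdiv (L s) (x l)) powr \<alpha> / infnorm (L s) powr \<alpha> * b l s" for l s
  define T where "T l = (\<integral>\<^sup>+s. ennreal (infnorm (vdiv (L s) (x l)) powr \<alpha> * b l s) \<partial>lborel)" for l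
  have H0: "0 \<le> H l s" for l s unfolding H_def b_def by simp
  have H: "H l \<in> borel_measurable borel" if "l \<in> {1..n}" for l
  proof -
    have iv: "(\<lambda>s. infnorm (vdiv (L (a + s)) (x j))) \<in> borel_measurable borel" for a j
      by (rule measurable_compose[OF _ infnorm_vdiv_measurable]) measurable
    have [measurable]: "(\<lambda>s. infnorm (vdiv (L s) (x l))) \<in> borel_measurable borel"
      using iv[of 0] by simp
    have [measurable]: "Measurable.pred borel
        (\<lambda>s. infargmax (\<le>) {1..n} (\<lambda>j. infnorm (vdiv (L (t j - t l + s)) (x j))) = l)"
      by (rule pred_infargmax[OF I le that iv])
    show ?thesis unfolding H_def b_def by measurable
  qed
  have "(\<integral>\<^sup>+w. ennreal (exponent_fun \<alpha> n t x (\<lambda>s. L (s - w))) \<partial>lborel)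
    = (\<integral>\<^sup>+w. ennreal (Max ((\<lambda>j. infnorm (vdiv (L (t j - w)) (x j)) powr \<alpha>) ` {1..n})) \<partial>lborel)"
    by (simp only: exponent_fun_eq_infnorm[OF \<alpha> n x L(2)])
  also have "\<dots> = (\<Sum>l\<in>{1..n}. T l)"
    unfolding T_def b_def
    by (rule nn_integral_Max_split[OF I le \<alpha>, where v="\<lambda>j y. infnorm (vdiv y (x j))"])
       (auto simp: infnorm_pos_le infnorm_vdiv_measurable)
  finally have split: "(\<integral>\<^sup>+w. ennreal (exponent_fun \<alpha> n t x (\<lambda>s. L (s - w))) \<partial>lborel) = (\<Sum>l\<in>{1..n}. T l)" .
  have "T l = (\<integral>\<^sup>+s. ennreal (infnorm (L s) powr \<alpha>) * ennreal (H l s) \<partial>lborel)" for l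
    unfolding T_def
  proof (rule nn_integral_cong)
    fix s
    show "ennreal (infnorm (vdiv (L s) (x l)) powr \<alpha> * b l s) = ennreal (infnorm (L s) powr \<alpha>) * ennreal (H l s)"
    proof (cases "L s = 0")
      case True
      then have "vdiv (L s) (x l) = 0" by (simp add: vdiv_def vec_eq_iff)
      then show ?thesis by (simp add: True infnorm_0)
    next
      case False
      then show ?thesis
        using H0 by (simp add: ennreal_mult[symmetric] H_def infnorm_eq_0)
    qed
  qed
  also have "(\<integral>\<^sup>+s. ennreal (infnorm (L s) powr \<alpha>) * ennreal (H l s) \<partial>lborel)
      = c * (\<integral>\<^sup>+\<omega>. ennreal (H l (S \<omega>)) \<partial>Q)" if "l \<in> {1..n}" for l
    unfolding c_def using H[OF that] by (intro nn_integral_has_alpha_density[OF S m]) auto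
  finally have T: "T l = c * (\<integral>\<^sup>+\<omega>. ennreal (H l (S \<omega>)) \<partial>Q)" if "l \<in> {1..n}" for l using that .
  have "enn2real (\<Sum>l\<in>{1..n}. T l) = (\<Sum>l\<in>{1..n}. enn2real (T l))"
    using fin unfolding split by (subst enn2real_sum) (auto simp: less_top[symmetric])
  also have "\<dots> = (\<Sum>l\<in>{1..n}. enn2real c * (LINT \<omega>|Q. H l (S \<omega>)))"
  proof (intro sum.cong refl)
    fix l assume l: "l \<in> {1..n}"
    have "(LINT \<omega>|Q. H l (S \<omega>)) = enn2real (\<integral>\<^sup>+\<omega>. ennreal (H l (S \<omega>)) \<partial>Q)"
      using H0 by (intro integral_eq_nn_integral measurable_compose[OF _ H[OF l]]) auto
    then show "enn2real (T l) = enn2real c * (LINT \<omega>|Q. H l (S \<omega>))"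
      by (simp add: T[OF l] enn2real_mult)
  qed
  finally show ?thesis unfolding split by (simp add: sum_distrib_left c_def H_def b_def)
qed

lemma smith_exponent_component_form:
  fixes L :: "real ^ 'p \<Rightarrow> real ^ 'd::{finite,linorder}"
  assumes \<alpha>: "0 < \<alpha>" and n: "1 \<le> n" and x: "\<And>j i. j \<in> {1..n} \<Longrightarrow> 0 < x j $ i"
    and L: "continuous_on UNIV L" "\<And>t i. 0 \<le> L t $ i"
    and m: "\<And>k. alpha_mass \<alpha> (\<lambda>t. L t $ k) \<noteq> 0" "\<And>k. alpha_mass \<alpha> (\<lambda>t. L t $ k) < \<infinity>"
    and S: "\<And>k. has_alpha_density \<alpha> (\<lambda>t. L t $ k) (Q k) (S k)"
  shows "(\<integral>\<^sup>+w. ennreal (exponent_fun \<alpha> n t x (\<lambda>s. L (s - w))) \<partial>lborel) < \<infinity>"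
    and "enn2real (\<integral>\<^sup>+w. ennreal (exponent_fun \<alpha> n t x (\<lambda>s. L (s - w))) \<partial>lborel) =
      (\<Sum>(k, l)\<in>UNIV \<times> {1..n}.
         enn2real (alpha_mass \<alpha> (\<lambda>t. L t $ k)) / (x l $ k) powr \<alpha> *
         measure (Q k) {\<omega> \<in> space (Q k).
           infargmax lex_le (UNIV \<times> {1..n})
             (\<lambda>(i, j). L (t j - t l + S k \<omega>) $ i / (x j $ i * L (S k \<omega>) $ k)) = (k, l)})"
proof -
  let ?J = "UNIV \<times> {1..n} :: ('d \<times> nat) set"
  have J: "finite ?J" "?J \<noteq> {}" using n by auto
  note le = total_order_on_lex_le[of ?J]
  have [measurable]: "L \<in> borel_measurable borel" using L(1) by (rule borel_measurable_continuous_onI)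
  have Ln[measurable]: "(\<lambda>s. L (a + s) $ i) \<in> borel_measurable borel" "(\<lambda>s. L s $ i) \<in> borel_measurable borel" for a i
    by (rule measurable_compose[OF _ vec_nth_borel_measurable]; measurable)+
  have [measurable]: "S k \<in> measurable (Q k) borel" for k
    using S[of k] by (auto simp: has_alpha_density_def distributed_def)
  have Q: "prob_space (Q k)" for k using S[of k] by (simp add: has_alpha_density_def)
  define c where "c k = alpha_mass \<alpha> (\<lambda>t. L t $ k)" for k
  define B where "B k l s \<longleftrightarrow> infargmax lex_le ?J (\<lambda>(i, j). L (t j - t l + s) $ i / (x j $ i * L s $ k)) = (k, l)" for k l s
  define T where "T kl = (\<integral>\<^sup>+s. ennreal ((L s $ fst kl / x (snd kl) $ fst kl) powr \<alpha>
      * of_bool (infargmax lex_le ?J (\<lambda>ij. L (t (snd ij) - t (snd kl) + s) $ fst ij / x (snd ij) $ fst ij) = kl)) \<partial>lborel)" for kl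
  have B[measurable]: "Measurable.pred borel (B k l)" if "(k, l) \<in> ?J" for k l
    unfolding B_def
  proof (rule pred_infargmax[OF J le that])
    show "(\<lambda>s. case ij of (i, j) \<Rightarrow> L (t j - t l + s) $ i / (x j $ i * L s $ k)) \<in> borel_measurable borel" for ij
      by (cases ij) simp
  qed
  have "(\<integral>\<^sup>+w. ennreal (exponent_fun \<alpha> n t x (\<lambda>s. L (s - w))) \<partial>lborel)
    = (\<integral>\<^sup>+w. ennreal (Max ((\<lambda>ij. (L (t (snd ij) - w) $ fst ij / x (snd ij) $ fst ij) powr \<alpha>) ` ?J)) \<partial>lborel)"
    unfolding exponent_fun_def by (simp add: case_prod_beta)
  also have "\<dots> = (\<Sum>kl\<in>?J. T kl)"
    unfolding T_def
    by (rule nn_integral_Max_split[OF J le \<alpha>, where v="\<lambda>ij y. y $ fst ij / x (snd ij) $ fst ij" and \<tau>="\<lambda>ij. t (snd ij)"])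
       (auto simp: L(2) less_imp_le[OF x] intro!: borel_measurable_divide vec_nth_borel_measurable)
  finally have split: "(\<integral>\<^sup>+w. ennreal (exponent_fun \<alpha> n t x (\<lambda>s. L (s - w))) \<partial>lborel) = (\<Sum>kl\<in>?J. T kl)" .
  have T: "T (k, l) = c k * (ennreal (1 / x l $ k powr \<alpha>) * emeasure (Q k) {\<omega> \<in> space (Q k). B k l (S k \<omega>)})"
    if kl: "(k, l) \<in> ?J" for k l
  proof -
    note [measurable] = B[OF kl]
    have xkl: "0 < x l $ k" using kl x by auto
    have "T (k, l) = (\<integral>\<^sup>+s. ennreal (L s $ k powr \<alpha>) * (ennreal (1 / x l $ k powr \<alpha>) * indicator {s. B k l s} s) \<partial>lborel)"
      unfolding T_def
    proof (rule nn_integral_cong)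
      fix s
      let ?A = "infargmax lex_le ?J (\<lambda>ij. L (t (snd ij) - t l + s) $ fst ij / x (snd ij) $ fst ij) = (k, l)"
      have "?A \<longleftrightarrow> B k l s" if "L s $ k \<noteq> 0"
      proof -
        have "0 < 1 / L s $ k" using that L(2)[of s k] by simp
        from infargmax_cmult[OF J le this kl, of "\<lambda>ij. L (t (snd ij) - t l + s) $ fst ij / x (snd ij) $ fst ij"]
        show ?thesis unfolding B_def by (simp add: case_prod_unfold mult.commute)
      qed
      then have "(L s $ k / x l $ k) powr \<alpha> * of_bool ?A = L s $ k powr \<alpha> * (1 / x l $ k powr \<alpha> * indicator {s. B k l s} s)"
        using xkl L(2)[of s k] by (cases "L s $ k = 0") (auto simp: powr_divide indicator_def)
      then show "ennreal ((L s $ fst (k, l) / x (snd (k, l)) $ fst (k, l)) powr \<alpha>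
        * of_bool (infargmax lex_le ?J (\<lambda>ij. L (t (snd ij) - t (snd (k, l)) + s) $ fst ij / x (snd ij) $ fst ij) = (k, l)))
        = ennreal (L s $ k powr \<alpha>) * (ennreal (1 / x l $ k powr \<alpha>) * indicator {s. B k l s} s)"
        by (simp add: ennreal_mult[symmetric] ennreal_indicator[symmetric])
    qed
    also have "\<dots> = c k * (\<integral>\<^sup>+\<omega>. ennreal (1 / x l $ k powr \<alpha>) * indicator {s. B k l s} (S k \<omega>) \<partial>Q k)"
      unfolding c_def by (rule nn_integral_has_alpha_density[OF S m]) measurable
    also have "(\<integral>\<^sup>+\<omega>. ennreal (1 / x l $ k powr \<alpha>) * indicator {s. B k l s} (S k \<omega>) \<partial>Q k)
      = (\<integral>\<^sup>+\<omega>. ennreal (1 / x l $ k powr \<alpha>) * indicator {\<omega> \<in> space (Q k). B k l (S k \<omega>)} \<omega> \<partial>Q k)"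
      by (intro nn_integral_cong) (simp add: indicator_def)
    also have "\<dots> = ennreal (1 / x l $ k powr \<alpha>) * emeasure (Q k) {\<omega> \<in> space (Q k). B k l (S k \<omega>)}"
      by (rule nn_integral_cmult_indicator) measurable
    finally show ?thesis .
  qed
  have T_fin: "T kl < \<infinity>" if kl: "kl \<in> ?J" for kl
  proof (cases kl)
    case (Pair k l)
    have "emeasure (Q k) A < \<infinity>" for A
      using le_less_trans[OF prob_space.emeasure_le_1[OF Q]] by simp
    then show ?thesis
      using T[of k l] m(2)[of k] kl by (simp add: Pair ennreal_mult_less_top c_def)
  qed
  show "(\<integral>\<^sup>+w. ennreal (exponent_fun \<alpha> n t x (\<lambda>s. L (s - w))) \<partial>lborel) < \<infinity>"
    unfolding split using T_fin J by simp
  have "enn2real (\<Sum>kl\<in>?J. T kl) = (\<Sum>kl\<in>?J. enn2real (T kl))"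
    using T_fin by (subst enn2real_sum) auto
  also have "\<dots> = (\<Sum>(k, l)\<in>?J. enn2real (c k) / (x l $ k) powr \<alpha> * measure (Q k) {\<omega> \<in> space (Q k). B k l (S k \<omega>)})"
  proof (intro sum.cong refl)
    fix kl assume "kl \<in> ?J"
    then show "enn2real (T kl) = (case kl of (k, l) \<Rightarrow>
        enn2real (c k) / (x l $ k) powr \<alpha> * measure (Q k) {\<omega> \<in> space (Q k). B k l (S k \<omega>)})"
      using T[of "fst kl" "snd kl"] by (cases kl) (simp add: enn2real_mult measure_def)
  qed
  finally show "enn2real (\<integral>\<^sup>+w. ennreal (exponent_fun \<alpha> n t x (\<lambda>s. L (s - w))) \<partial>lborel) =
      (\<Sum>(k, l)\<in>UNIV \<times> {1..n}.
         enn2real (alpha_mass \<alpha> (\<lambda>t. L t $ k)) / (x l $ k) powr \<alpha> *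
         measure (Q k) {\<omega> \<in> space (Q k).
           infargmax lex_le (UNIV \<times> {1..n})
             (\<lambda>(i, j). L (t j - t l + S k \<omega>) $ i / (x j $ i * L (S k \<omega>) $ k)) = (k, l)})"
    unfolding split c_def B_def .
qed

theorem lemma4p1:
  fixes \<alpha> :: real
    and L :: "real ^ 'p \<Rightarrow> real ^ 'd::{finite,linorder}"
    and N\<^sub>s :: "real ^ 'd::{finite,linorder} \<Rightarrow> real"
    and M :: "'m measure" and W :: "'m \<Rightarrow> real ^ 'p" and p :: "real ^ 'p \<Rightarrow> real"
    and P :: "'x measure" and X :: "'x \<Rightarrow> real ^ 'p \<Rightarrow> real ^ 'd::{finite,linorder}"
  defines "Z \<equiv> smith_spectral \<alpha> p L W"
  assumes "\<alpha> > 0"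
    and "\<And>i. continuous_on UNIV (\<lambda>t. L t $ i)"
    and "\<And>t i. 0 \<le> L t $ i"
    and "is_norm N\<^sub>s"
    and "\<And>K. compact K \<Longrightarrow> K \<noteq> {} \<Longrightarrow>
           0 < (\<integral>\<^sup>+t. ennreal (N\<^sub>s (L t) powr \<alpha>) \<partial>lborel) \<and>
           (\<integral>\<^sup>+t. ennreal (N\<^sub>s (L t) powr \<alpha>) \<partial>lborel)
             \<le> (\<integral>\<^sup>+t. (SUP s\<in>K. ennreal (N\<^sub>s (L (t - s)) powr \<alpha>)) \<partial>lborel) \<and>
           (\<integral>\<^sup>+t. (SUP s\<in>K. ennreal (N\<^sub>s (L (t - s)) powr \<alpha>)) \<partial>lborel) < \<infinity>"
    and "prob_space M"
    and "distributed M lborel W (\<lambda>t. ennreal (p t))"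
    and "\<And>t. 0 < p t"
    and "spectral_process TYPE('r) \<alpha> M Z P X"
  shows
    "(\<forall>h N. is_norm N \<longrightarrow>
        0 < alpha_mass \<alpha> (\<lambda>t. N (L t)) \<and> alpha_mass \<alpha> (\<lambda>t. N (L t)) < \<infinity> \<and>
        (\<forall>(Q :: 'q measure) S. has_alpha_density \<alpha> (\<lambda>t. N (L t)) Q S \<longrightarrow>
           tilted_law \<alpha> N M Z h = distr Q path_space (\<lambda>\<omega> t. L (t - h + S \<omega>) /\<^sub>R N (L (S \<omega>)))) \<and>
        tilted_law \<alpha> N M Z h = distr (tilted_law \<alpha> N M Z 0) path_space (backshift h)) \<and>
     (\<forall>h k. 0 < alpha_mass \<alpha> (\<lambda>t. L t $ k) \<longrightarrow>
        alpha_mass \<alpha> (\<lambda>t. L t $ k) < \<infinity> \<and>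
        (\<forall>(Q :: 'q measure) S. has_alpha_density \<alpha> (\<lambda>t. L t $ k) Q S \<longrightarrow>
           tilted_law \<alpha> (\<lambda>z. z $ k) M Z h =
             distr Q path_space (\<lambda>\<omega> t. L (t - h + S \<omega>) /\<^sub>R (L (S \<omega>) $ k)))) \<and>
     ((\<forall>k. 0 < alpha_mass \<alpha> (\<lambda>t. L t $ k) \<and> alpha_mass \<alpha> (\<lambda>t. L t $ k) < \<infinity>) \<longrightarrow>
        (\<forall>(n::nat) (t :: nat \<Rightarrow> real ^ 'p) (x :: nat \<Rightarrow> real ^ 'd::{finite,linorder})
            (Q :: 'q measure) S (Q\<^sub>c :: 'd::{finite,linorder} \<Rightarrow> 'u measure) S\<^sub>c.
          1 \<le> n \<longrightarrow> (\<forall>j\<in>{1..n}. \<forall>i. 0 < x j $ i) \<longrightarrow>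
          has_alpha_density \<alpha> (\<lambda>t. infnorm (L t)) Q S \<longrightarrow>
          (\<forall>k. has_alpha_density \<alpha> (\<lambda>t. L t $ k) (Q\<^sub>c k) (S\<^sub>c k)) \<longrightarrow>
          - ln (measure P {\<omega> \<in> space P. \<forall>j\<in>{1..n}. X \<omega> (t j) \<le> x j}) =
            enn2real (alpha_mass \<alpha> (\<lambda>t. infnorm (L t))) *
            (\<Sum>l\<in>{1..n}. LINT \<omega>|Q.
               infnorm (vdiv (L (S \<omega>)) (x l)) powr \<alpha> / infnorm (L (S \<omega>)) powr \<alpha> *
               of_bool (infargmax (\<le>) {1..n}
                          (\<lambda>j. infnorm (vdiv (L (t j - t l + S \<omega>)) (x j))) = l)) \<and>
          - ln (measure P {\<omega> \<in> space P. \<forall>j\<in>{1..n}. X \<omega> (t j) \<le> x j}) =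
            (\<Sum>(k, l)\<in>UNIV \<times> {1..n}.
               enn2real (alpha_mass \<alpha> (\<lambda>t. L t $ k)) / (x l $ k) powr \<alpha> *
               measure (Q\<^sub>c k) {\<omega> \<in> space (Q\<^sub>c k).
                 infargmax lex_le (UNIV \<times> {1..n})
                   (\<lambda>(i, j). L (t j - t l + S\<^sub>c k \<omega>) $ i / (x j $ i * L (S\<^sub>c k \<omega>) $ k))
                 = (k, l)})))"
proof -
  have Z: "Z = smith_spectral \<alpha> p L W" by (simp add: Z_def)
  note \<alpha> = assms(2) and W = assms(8) and p = assms(9) and sp = assms(10)
  have L0: "0 \<le> L t $ i" for t i by (rule assms(4))
  have "continuous_on UNIV (\<lambda>t. \<chi> i. L t $ i)"
    by (intro continuous_on_vec_lambda assms(3))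
  then have L: "continuous_on UNIV L" by simp
  have comp_measurable: "(\<lambda>t. f (L t)) \<in> borel_measurable borel" if "continuous_on UNIV f" for f :: "_ \<Rightarrow> real"
    by (rule borel_measurable_continuous_onI, rule continuous_on_compose2[OF that L]) simp

  have Ns: "0 < alpha_mass \<alpha> (\<lambda>t. N\<^sub>s (L t))" "alpha_mass \<alpha> (\<lambda>t. N\<^sub>s (L t)) < \<infinity>"
    using assms(6)[of "{0}"] unfolding alpha_mass_def by (auto intro: le_less_trans)
  have mass: "0 < alpha_mass \<alpha> (\<lambda>t. N (L t))" "alpha_mass \<alpha> (\<lambda>t. N (L t)) < \<infinity>" if N: "is_norm N" for N
  proof -
    have le: "\<exists>C. alpha_mass \<alpha> (\<lambda>t. f (L t)) \<le> ennreal C * alpha_mass \<alpha> (\<lambda>t. g (L t))"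
      if f: "is_norm f" and g: "is_norm g" for f g
    proof -
      obtain C where C: "0 < C" "\<And>x. f x \<le> C * g x" using is_norm_equiv[OF f g] by blast
      then show ?thesis
        using f g \<alpha> unfolding is_norm_def
        by (intro exI[of _ "C powr \<alpha>"] alpha_mass_mono comp_measurable is_norm_continuous[OF g]) auto
    qed
    obtain C where "alpha_mass \<alpha> (\<lambda>t. N (L t)) \<le> ennreal C * alpha_mass \<alpha> (\<lambda>t. N\<^sub>s (L t))"
      using le[OF N assms(5)] by auto
    then show "alpha_mass \<alpha> (\<lambda>t. N (L t)) < \<infinity>"
      using Ns(2) by (auto intro: le_less_trans simp: ennreal_mult_less_top)
    obtain C' where C': "alpha_mass \<alpha> (\<lambda>t. N\<^sub>s (L t)) \<le> ennreal C' * alpha_mass \<alpha> (\<lambda>t. N (L t))"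
      using le[OF assms(5) N] by auto
    show "0 < alpha_mass \<alpha> (\<lambda>t. N (L t))"
    proof (rule ccontr)
      assume "\<not> 0 < alpha_mass \<alpha> (\<lambda>t. N (L t))"
      then have "alpha_mass \<alpha> (\<lambda>t. N (L t)) = 0" by (simp add: zero_less_iff_neq_zero)
      then show False using C' Ns(1) by simp
    qed
  qed
  have comp_fin: "alpha_mass \<alpha> (\<lambda>t. L t $ k) < \<infinity>" for k
  proof -
    have "L t $ k \<le> 1 * infnorm (L t)" for t
      using component_le_infnorm_cart[of "L t" k] by simp
    then have "alpha_mass \<alpha> (\<lambda>t. L t $ k) \<le> ennreal (1 powr \<alpha>) * alpha_mass \<alpha> (\<lambda>t. infnorm (L t))"
      using \<alpha> L0 infnorm_pos_le
      by (intro alpha_mass_mono comp_measurable is_norm_continuous[OF is_norm_infnorm]) auto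
    also have "\<dots> < \<infinity>" using mass(2)[OF is_norm_infnorm] by simp
    finally show ?thesis .
  qed

  have norm_law: "tilted_law \<alpha> N M Z h =
      distr (density lborel (\<lambda>s. ennreal (N (L s) powr \<alpha>) / alpha_mass \<alpha> (\<lambda>t. N (L t)))) path_space
        (\<lambda>s t. L (t - h + s) /\<^sub>R N (L s))"
    and norm_meas: "(\<lambda>s t. L (t - h + s) /\<^sub>R N (L s)) \<in> measurable borel path_space"
    if N: "is_norm N" for N h
    unfolding Z using N
    by (intro tilted_law_smith[OF \<alpha> L L0 _ _ _ W p] borel_measurable_continuous_onI is_norm_continuous;
        simp add: is_norm_def)+
  have comp_law: "tilted_law \<alpha> (\<lambda>z. z $ k) M Z h =
      distr (density lborel (\<lambda>s. ennreal (L s $ k powr \<alpha>) / alpha_mass \<alpha> (\<lambda>t. L t $ k))) path_space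
        (\<lambda>s t. L (t - h + s) /\<^sub>R (L s $ k))"
    and comp_meas: "(\<lambda>s t. L (t - h + s) /\<^sub>R (L s $ k)) \<in> measurable borel path_space" for h k
    unfolding Z
    by (rule tilted_law_smith[where g="\<lambda>z. z $ k", OF \<alpha> L L0 vec_nth_borel_measurable _ L0 W p]; simp)+

  have part_a: "tilted_law \<alpha> N M Z h = distr Q path_space (\<lambda>\<omega> t. L (t - h + S \<omega>) /\<^sub>R N (L (S \<omega>)))"
    if "is_norm N" "has_alpha_density \<alpha> (\<lambda>t. N (L t)) Q S" for N h S and Q :: "'q measure"
    unfolding norm_law[OF that(1)] distr_has_alpha_density[OF that(2) norm_meas[OF that(1)]] ..
  have part_a_shift: "tilted_law \<alpha> N M Z h = distr (tilted_law \<alpha> N M Z 0) path_space (backshift h)"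
    if "is_norm N" for N h
    unfolding norm_law[OF that]
    by (subst distr_distr)
       (use norm_meas[OF that, of 0] in \<open>auto simp: comp_def backshift_def measurable_density_eq1\<close>)
  have part_b: "tilted_law \<alpha> (\<lambda>z. z $ k) M Z h = distr Q path_space (\<lambda>\<omega> t. L (t - h + S \<omega>) /\<^sub>R (L (S \<omega>) $ k))"
    if "has_alpha_density \<alpha> (\<lambda>t. L t $ k) Q S" for k h S and Q :: "'q measure"
    unfolding comp_law distr_has_alpha_density[OF that comp_meas] ..

  have part_c: "- ln (measure P {\<omega> \<in> space P. \<forall>j\<in>{1..n}. X \<omega> (t j) \<le> x j}) =
      enn2real (\<integral>\<^sup>+w. ennreal (exponent_fun \<alpha> n t x (\<lambda>s. L (s - w))) \<partial>lborel)"
    if n: "1 \<le> n" and x: "\<And>j i. j \<in> {1..n} \<Longrightarrow> 0 < x j $ i"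
      and fin: "(\<integral>\<^sup>+w. ennreal (exponent_fun \<alpha> n t x (\<lambda>s. L (s - w))) \<partial>lborel) < \<infinity>"
    for n t x
  proof -
    have nn: "(\<integral>\<^sup>+\<omega>. ennreal (exponent_fun \<alpha> n t x (Z \<omega>)) \<partial>M)
      = (\<integral>\<^sup>+w. ennreal (exponent_fun \<alpha> n t x (\<lambda>s. L (s - w))) \<partial>lborel)"
      unfolding Z by (rule nn_integral_exponent_fun_smith[OF \<alpha> n x L L0 W p])
    have mZ: "(\<lambda>\<omega>. exponent_fun \<alpha> n t x (Z \<omega>)) \<in> borel_measurable M"
      using sp unfolding spectral_process_def by (auto intro: measurable_compose[OF _ exponent_fun_measurable])
    have "integrable M (\<lambda>\<omega>. exponent_fun \<alpha> n t x (Z \<omega>))"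
      using mZ fin by (intro integrableI_nonneg) (auto simp: nn exponent_fun_nonneg[OF n])
    from spectral_process_void_prob[OF sp \<alpha> n x this]
    have "- ln (measure P {\<omega> \<in> space P. \<forall>j\<in>{1..n}. X \<omega> (t j) \<le> x j})
      = (LINT \<omega>|M. exponent_fun \<alpha> n t x (Z \<omega>))" by simp
    also have "\<dots> = enn2real (\<integral>\<^sup>+\<omega>. ennreal (exponent_fun \<alpha> n t x (Z \<omega>)) \<partial>M)"
      using mZ by (intro integral_eq_nn_integral) (auto simp: exponent_fun_nonneg[OF n])
    finally show ?thesis unfolding nn .
  qed
  have inf_mass: "alpha_mass \<alpha> (\<lambda>t. infnorm (L t)) \<noteq> 0" "alpha_mass \<alpha> (\<lambda>t. infnorm (L t)) < \<infinity>"
    using mass[OF is_norm_infnorm] by auto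
  show ?thesis
  proof (intro conjI allI impI)
    fix h :: "real ^ 'p" and N :: "real ^ 'd::{finite,linorder} \<Rightarrow> real" assume "is_norm N"
    then show "0 < alpha_mass \<alpha> (\<lambda>t. N (L t))" "alpha_mass \<alpha> (\<lambda>t. N (L t)) < \<infinity>"
      "tilted_law \<alpha> N M Z h = distr (tilted_law \<alpha> N M Z 0) path_space (backshift h)"
      by (fact mass part_a_shift)+
    fix Q :: "'q measure" and S :: "'q \<Rightarrow> real ^ 'p" assume "has_alpha_density \<alpha> (\<lambda>t. N (L t)) Q S"
    with \<open>is_norm N\<close> show "tilted_law \<alpha> N M Z h = distr Q path_space (\<lambda>\<omega> t. L (t - h + S \<omega>) /\<^sub>R N (L (S \<omega>)))"
      by (rule part_a)
  next
    fix h :: "real ^ 'p" and k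
    show "alpha_mass \<alpha> (\<lambda>t. L t $ k) < \<infinity>" by (rule comp_fin)
    fix Q :: "'q measure" and S :: "'q \<Rightarrow> real ^ 'p" assume "has_alpha_density \<alpha> (\<lambda>t. L t $ k) Q S"
    then show "tilted_law \<alpha> (\<lambda>z. z $ k) M Z h =
             distr Q path_space (\<lambda>\<omega> t. L (t - h + S \<omega>) /\<^sub>R (L (S \<omega>) $ k))"
      by (rule part_b)
  next
    fix n :: nat and t :: "nat \<Rightarrow> real ^ 'p" and x :: "nat \<Rightarrow> real ^ 'd::{finite,linorder}"
      and Q :: "'q measure" and S :: "'q \<Rightarrow> real ^ 'p"
      and Q\<^sub>c :: "'d::{finite,linorder} \<Rightarrow> 'u measure" and S\<^sub>c :: "'d::{finite,linorder} \<Rightarrow> 'u \<Rightarrow> real ^ 'p"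
    assume "\<forall>k. 0 < alpha_mass \<alpha> (\<lambda>t. L t $ k) \<and> alpha_mass \<alpha> (\<lambda>t. L t $ k) < \<infinity>"
      and n: "1 \<le> n" and "\<forall>j\<in>{1..n}. \<forall>i. 0 < x j $ i"
      and S: "has_alpha_density \<alpha> (\<lambda>t. infnorm (L t)) Q S"
      and "\<forall>k. has_alpha_density \<alpha> (\<lambda>t. L t $ k) (Q\<^sub>c k) (S\<^sub>c k)"
    then have m: "\<And>k. alpha_mass \<alpha> (\<lambda>t. L t $ k) \<noteq> 0" "\<And>k. alpha_mass \<alpha> (\<lambda>t. L t $ k) < \<infinity>"
      and x: "\<And>j i. j \<in> {1..n} \<Longrightarrow> 0 < x j $ i"
      and Sc: "\<And>k. has_alpha_density \<alpha> (\<lambda>t. L t $ k) (Q\<^sub>c k) (S\<^sub>c k)"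
      by (auto simp: zero_less_iff_neq_zero)
    note comp = smith_exponent_component_form[where t=t and x=x, OF \<alpha> n x L L0 m Sc]
    note c = part_c[OF n x comp(1)]
    show "- ln (measure P {\<omega> \<in> space P. \<forall>j\<in>{1..n}. X \<omega> (t j) \<le> x j}) =
            enn2real (alpha_mass \<alpha> (\<lambda>t. infnorm (L t))) *
            (\<Sum>l\<in>{1..n}. LINT \<omega>|Q.
               infnorm (vdiv (L (S \<omega>)) (x l)) powr \<alpha> / infnorm (L (S \<omega>)) powr \<alpha> *
               of_bool (infargmax (\<le>) {1..n}
                          (\<lambda>j. infnorm (vdiv (L (t j - t l + S \<omega>)) (x j))) = l))"
      by (rule trans[OF c smith_exponent_norm_form[OF \<alpha> n x L L0 inf_mass S comp(1)]])
    show "- ln (measure P {\<omega> \<in> space P. \<forall>j\<in>{1..n}. X \<omega> (t j) \<le> x j}) =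
            (\<Sum>(k, l)\<in>UNIV \<times> {1..n}.
               enn2real (alpha_mass \<alpha> (\<lambda>t. L t $ k)) / (x l $ k) powr \<alpha> *
               measure (Q\<^sub>c k) {\<omega> \<in> space (Q\<^sub>c k).
                 infargmax lex_le (UNIV \<times> {1..n})
                   (\<lambda>(i, j). L (t j - t l + S\<^sub>c k \<omega>) $ i / (x j $ i * L (S\<^sub>c k \<omega>) $ k))
                 = (k, l)})"
      by (rule trans[OF c comp(2)])
  qed
qed

end
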